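(* Let $z_1,z_2,z_3\in\mathbb{C}\setminus\{0,1\}$ be pairwise distinct, and let $c_0,\dots,c_5\in\mathbb{C}$ satisfy $c_0+\cdots+c_5=0$ and $4c_j\notin\mathbb{Z}$ for $j=0,\dots,5$. With $X$, $\nabla$, $H^{(1)}$ and $H^{(-1)}$ as in the context, consider the $1$-forms on $X$ $$\varphi_1=\frac{dx}{x-1},\quad \varphi_2=\frac{dx}{x(x-1)},\quad \varphi_3=\frac{(1-z_1)\,dx}{(x-1)(x-z_1)},\quad \varphi_4=\frac{(1-z_2)\,dx}{(x-1)(x-z_2)},$$ $$\varphi_5=\frac{x\,dx}{y},\quad \varphi_6=\frac{dx}{y},\quad \varphi_7=(1-z_1)\frac{x\,dx}{(x-z_1)y},\quad \varphi_8=(1-z_2)\frac{x\,dx}{(x-z_2)y}.$$ Then the classes of $\varphi_1,\dots,\varphi_4$ form a basis of $H^{(1)}$, and the classes of $\varphi_5,\dots,\varphi_8$ form a basis of $H^{(-1)}$. In particular, $\varphi_1,\dots,\varphi_8$ form a basis of $H^1(X;\nabla)$.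
   Context: Put $z_0=0$, $z_4=1$. Let $\bar X$ be the smooth projective genus two curve $y^2=x(x-1)(x-z_1)(x-z_2)(x-z_3)$, and set $P_0=(0,0)$, $P_j=(z_j,0)$ for $j=1,2,3$, $P_4=(1,0)$, and $P_5$ = the point at infinity. Let $X=\bar X\setminus\{P_0,\dots,P_5\}$, with hyperelliptic involution $\iota:(x,y)\mapsto(x,-y)$. Let $T=\prod_{j=0}^4(x-z_j)^{2c_j}$, a multivalued function on $X$, and let $\nabla=d+d\log T\wedge$, acting on regular functions of $X$. The twisted de Rham cohomology group is $H^1(X;\nabla)=\Omega^1_X(X)/\nabla\mathcal{O}_X(X)$. Since $\iota^*d\log T=d\log T$, pullback of forms induces an involution $\iota^*$ of $H^1(X;\nabla)$; put $H^{(\pm1)}=\{\varphi\in H^1(X;\nabla)\mid \iota^*\varphi=\pm\varphi\}$, so that $H^1(X;\nabla)=H^{(1)}\oplus H^{(-1)}$. *)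

theory Defs
  imports
    "HOL-Algebra.Algebraic_Closure_Type"
    "HOL-Analysis.Derivative"
    "HOL-Computational_Algebra.Polynomial"
begin

section \<open>Quotient modules and bases\<close>

text \<open>The quotient of a module by a submodule \<open>N\<close>. The carrier and the addition are those of
  \<open>M A_Mod N\<close>; the multiplicative fields of the record play no role for a module.\<close>

definition quot_module :: "('a, 'b, 'c) module_scheme \<Rightarrow> 'b set \<Rightarrow> ('a, 'b set) module" where
  "quot_module M N =
    \<lparr>carrier = a_rcosets\<^bsub>M\<^esub> N, monoid.mult = undefined, one = undefined,
     ring.zero = N, add = (\<lambda>A B. A <+>\<^bsub>M\<^esub> B),
     module.smult = (\<lambda>a A. \<Union>x\<in>A. N +>\<^bsub>M\<^esub> (a \<odot>\<^bsub>M\<^esub> x))\<rparr>"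

definition module_basis ::
  "('a, 'r) ring_scheme \<Rightarrow> ('a, 'b, 'm) module_scheme \<Rightarrow> 'i set \<Rightarrow> ('i \<Rightarrow> 'b) \<Rightarrow> bool" where
  "module_basis R M I v \<longleftrightarrow>
     finite I \<and> v \<in> I \<rightarrow> carrier M \<and>
     (\<forall>a \<in> I \<rightarrow> carrier R.
        (\<Oplus>\<^bsub>M\<^esub>i\<in>I. a i \<odot>\<^bsub>M\<^esub> v i) = \<zero>\<^bsub>M\<^esub> \<longrightarrow> (\<forall>i\<in>I. a i = \<zero>\<^bsub>R\<^esub>)) \<and>
     (\<forall>x \<in> carrier M. \<exists>a \<in> I \<rightarrow> carrier R. x = (\<Oplus>\<^bsub>M\<^esub>i\<in>I. a i \<odot>\<^bsub>M\<^esub> v i))"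


section \<open>The punctured genus two curve\<close>

type_synonym point = "complex \<times> complex"
type_synonym form = "point \<Rightarrow> point \<Rightarrow> complex"

text \<open>Throughout, \<open>z :: nat \<Rightarrow> complex\<close> lists the finite branch points \<open>z 0, \<dots>, z 4\<close>.\<close>

definition quintic :: "(nat \<Rightarrow> complex) \<Rightarrow> complex poly" where
  "quintic z = (\<Prod>j\<le>4. [:- z j, 1:])"

text \<open>The affine equation describes the complement of the single point at infinity of the smooth
  projective curve, so only the five finite Weierstrass points have to be removed explicitly.\<close>

definition curve :: "(nat \<Rightarrow> complex) \<Rightarrow> point set" where
  "curve z = {(x, y). y\<^sup>2 = poly (quintic z) x} - {(z j, 0) | j. j \<le> 4}"

text \<open>The kernel of the differential of \<open>y\<^sup>2 - poly (quintic z) x\<close> at the given point.\<close>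

definition tangent_space :: "(nat \<Rightarrow> complex) \<Rightarrow> point \<Rightarrow> point set" where
  "tangent_space z = (\<lambda>(x, y). {(u, v). 2 * y * v = poly (pderiv (quintic z)) x * u})"

text \<open>Polynomials in \<open>x\<close>, \<open>y\<close> are polynomials in \<open>y\<close> whose coefficients are polynomials in \<open>x\<close>.\<close>

definition eval2 :: "complex poly poly \<Rightarrow> point \<Rightarrow> complex" where
  "eval2 F = (\<lambda>(x, y). poly (poly F [:y:]) x)"

text \<open>Regular functions and regular 1-forms (sections of the cotangent bundle) are, locally in
  the Zariski topology, of the form \<open>F/G\<close> and \<open>(A dx + B dy)/G\<close> with polynomials \<open>F, A, B, G\<close>.
  They are extended by zero outside the curve, respectively outside the tangent bundle, so that
  equality of HOL functions is equality on the curve.\<close>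

definition regular_functions :: "(nat \<Rightarrow> complex) \<Rightarrow> (point \<Rightarrow> complex) set" where
  "regular_functions z =
    {g. (\<forall>P. P \<notin> curve z \<longrightarrow> g P = 0) \<and>
        (\<forall>P \<in> curve z. \<exists>F G. eval2 G P \<noteq> 0 \<and>
           (\<forall>Q \<in> curve z. eval2 G Q \<noteq> 0 \<longrightarrow> g Q = eval2 F Q / eval2 G Q))}"

definition regular_forms :: "(nat \<Rightarrow> complex) \<Rightarrow> form set" where
  "regular_forms z =
    {\<omega>. (\<forall>P w. P \<notin> curve z \<or> w \<notin> tangent_space z P \<longrightarrow> \<omega> P w = 0) \<and>
        (\<forall>P \<in> curve z. \<exists>A B G. eval2 G P \<noteq> 0 \<and>
           (\<forall>Q \<in> curve z. eval2 G Q \<noteq> 0 \<longrightarrow>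
              (\<forall>w \<in> tangent_space z Q.
                 \<omega> Q w = (eval2 A Q * fst w + eval2 B Q * snd w) / eval2 G Q)))}"

definition forms_module :: "(nat \<Rightarrow> complex) \<Rightarrow> (complex, form) module" where
  "forms_module z =
    \<lparr>carrier = regular_forms z, monoid.mult = undefined, one = undefined,
     ring.zero = (\<lambda>P w. 0), add = (\<lambda>\<omega> \<eta> P w. \<omega> P w + \<eta> P w),
     module.smult = (\<lambda>a \<omega> P w. a * \<omega> P w)\<rparr>"

text \<open>The 1-form \<open>h dx\<close> on the curve.\<close>

definition dx_form :: "(nat \<Rightarrow> complex) \<Rightarrow> (point \<Rightarrow> complex) \<Rightarrow> form" where
  "dx_form z h = (\<lambda>P w. if P \<in> curve z \<and> w \<in> tangent_space z P then h P * fst w else 0)"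

text \<open>The differential of a regular function. Derivatives of \<open>g\<close> at \<open>P\<close> within the curve are not
  unique as maps on \<open>\<complex>\<^sup>2\<close>, but all of them agree on the tangent space at \<open>P\<close>.\<close>

definition ext_deriv :: "(nat \<Rightarrow> complex) \<Rightarrow> (point \<Rightarrow> complex) \<Rightarrow> form" where
  "ext_deriv z g = (\<lambda>P w. if P \<in> curve z \<and> w \<in> tangent_space z P
     then frechet_derivative g (at P within curve z) w else 0)"


section \<open>Twisted de Rham cohomology\<close>

text \<open>\<open>d log T\<close> for the multivalued function \<open>T = (\<Prod>j\<le>4. (x - z j) powr (2 * c j))\<close>.\<close>

definition dlog_T :: "(nat \<Rightarrow> complex) \<Rightarrow> (nat \<Rightarrow> complex) \<Rightarrow> form" where
  "dlog_T z c = dx_form z (\<lambda>(x, y). \<Sum>j\<le>4. 2 * c j / (x - z j))"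

definition nabla :: "(nat \<Rightarrow> complex) \<Rightarrow> (nat \<Rightarrow> complex) \<Rightarrow> (point \<Rightarrow> complex) \<Rightarrow> form" where
  "nabla z c g = (\<lambda>P w. ext_deriv z g P w + g P * dlog_T z c P w)"

definition H1 :: "(nat \<Rightarrow> complex) \<Rightarrow> (nat \<Rightarrow> complex) \<Rightarrow> (complex, form set) module" where
  "H1 z c = quot_module (forms_module z) (nabla z c ` regular_functions z)"

definition H1_class :: "(nat \<Rightarrow> complex) \<Rightarrow> (nat \<Rightarrow> complex) \<Rightarrow> form \<Rightarrow> form set" where
  "H1_class z c \<omega> = (nabla z c ` regular_functions z) +>\<^bsub>forms_module z\<^esub> \<omega>"

definition iota :: "point \<Rightarrow> point" where
  "iota = (\<lambda>(x, y). (x, - y))"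

text \<open>As \<open>iota\<close> is linear on \<open>\<complex>\<^sup>2\<close>, it is its own tangent map.\<close>

definition iota_pullback :: "form \<Rightarrow> form" where
  "iota_pullback \<omega> = (\<lambda>P w. \<omega> (iota P) (iota w))"

text \<open>The pullback preserves \<open>nabla z c ` regular_functions z\<close>, so the involution induced on
  cohomology classes is the image map on cosets. The eigenvalue \<open>s\<close> is \<open>1\<close> or \<open>-1\<close>.\<close>

definition H1_eigen ::
  "(nat \<Rightarrow> complex) \<Rightarrow> (nat \<Rightarrow> complex) \<Rightarrow> complex \<Rightarrow> (complex, form set) module" where
  "H1_eigen z c s = (H1 z c)
     \<lparr>carrier := {A \<in> carrier (H1 z c). iota_pullback ` A = s \<odot>\<^bsub>H1 z c\<^esub> A}\<rparr>"

end

theory Submission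
  imports Defs "HOL-Analysis.Complex_Transcendental"
begin

text \<open>Write \<open>q\<close> for the quintic. Every regular function on the curve is \<open>(A + B/y) / q ^ n\<close> with
  polynomials \<open>A\<close>, \<open>B\<close> in \<open>x\<close>, and every regular 1-form is such a function times \<open>dx\<close>. On the even
  and on the odd part \<open>\<nabla>\<close> acts as \<open>f \<mapsto> f' + (\<Sum>j. l j / (x - z j)) f\<close> on rational functions of \<open>x\<close>
  with poles at the branch points, where \<open>l j\<close> is \<open>2 c j\<close> or \<open>2 c j - 1/2\<close>. By genericity neither
  an \<open>l j\<close> nor \<open>\<Sum>j. l j\<close> is an integer, so applying \<open>\<nabla>\<close> to a nonpolynomial \<open>f\<close> raises the order of
  each of its poles by one, to at least two, and applying it to a polynomial lowers the degree by
  exactly one. Hence one can reduce modulo the image to simple poles and bounded growth at infinity.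
  Let \<open>J\<close> be a nonempty set of branch points. The images of the polynomials of degree less than \<open>card J\<close>
  have arbitrary residues at \<open>J\<close>; removing the poles at \<open>J\<close> with them identifies the cokernel
  with the functions \<open>S / (\<Prod>j\<notin>J. (x - z j))\<close>, \<open>degree S \<le> 3\<close>. For \<open>J = {3}\<close> in the even and
  \<open>J = {0, 3, 4}\<close> in the odd case, the numerators \<open>S\<close> of the given forms are the same four cubics,
  a basis of the polynomials of degree at most three.\<close>

section \<open>Twisted derivatives of rational functions of one variable\<close>

definition root_poly :: "('i \<Rightarrow> 'a) \<Rightarrow> 'i set \<Rightarrow> 'a::field_char_0 poly" where
  "root_poly e I = (\<Prod>i\<in>I. [:- e i, 1:])"

definition weight_poly :: "('i \<Rightarrow> 'a) \<Rightarrow> ('i \<Rightarrow> 'a) \<Rightarrow> 'i set \<Rightarrow> 'a::field_char_0 poly" where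
  "weight_poly l e I = (\<Sum>i\<in>I. Polynomial.smult (l i) (root_poly e (I - {i})))"

text \<open>With \<open>q = root_poly e I\<close> and \<open>\<ell> = (\<Sum>i\<in>I. l i / (x - e i))\<close>, the twisted derivative
  \<open>f' + \<ell> f\<close> of \<open>f = A / q ^ n\<close> is \<open>twisted_num l e I n A / q ^ (n + 1)\<close>.\<close>

definition twisted_num ::
    "('i \<Rightarrow> 'a) \<Rightarrow> ('i \<Rightarrow> 'a) \<Rightarrow> 'i set \<Rightarrow> nat \<Rightarrow> 'a poly \<Rightarrow> 'a::field_char_0 poly" where
  "twisted_num l e I n A =
     pderiv A * root_poly e I + A * (weight_poly l e I - of_nat n * pderiv (root_poly e I))"

text \<open>Only the summand \<open>i = a\<close> of the convolution survives. The bounds need not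
  be attained, so top coefficients that may vanish are covered.\<close>

lemma coeff_mult_add:
  fixes p r :: "'a::comm_semiring_0 poly"
  assumes "degree p \<le> a" "degree r \<le> b"
  shows "coeff (p * r) (a + b) = coeff p a * coeff r b"
proof -
  have "coeff (p * r) (a + b) = (\<Sum>i\<le>a + b. coeff p i * coeff r (a + b - i))"
    by (rule coeff_mult)
  also have "\<dots> = (\<Sum>i\<in>{a}. coeff p i * coeff r (a + b - i))"
  proof (rule sum.mono_neutral_right)
    show "\<forall>i\<in>{..a + b} - {a}. coeff p i * coeff r (a + b - i) = 0"
    proof
      fix i assume "i \<in> {..a + b} - {a}"
      then consider "i > a" | "a + b - i > b" by fastforce
      then show "coeff p i * coeff r (a + b - i) = 0"
        by cases (use assms in \<open>simp_all add: coeff_eq_0\<close>)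
    qed
  qed auto
  finally show ?thesis by simp
qed

section \<open>Products of linear factors and interpolation\<close>

lemma poly_root_poly: "poly (root_poly e I) x = (\<Prod>i\<in>I. x - e i)"
  by (simp add: root_poly_def poly_prod)

lemma poly_root_poly_0_iff: "finite I \<Longrightarrow> poly (root_poly e I) x = 0 \<longleftrightarrow> x \<in> e ` I"
  by (auto simp: poly_root_poly)

lemma root_poly_nonzero [simp]: "finite I \<Longrightarrow> root_poly e I \<noteq> 0"
  by (simp add: root_poly_def)

lemma degree_root_poly [simp]: "finite I \<Longrightarrow> degree (root_poly e I) = card I"
  unfolding root_poly_def by (subst degree_prod_eq_sum_degree) auto

lemma coeff_root_poly [simp]: "finite I \<Longrightarrow> coeff (root_poly e I) (card I) = 1"
  using lead_coeff_prod[of "\<lambda>i. [:- e i, 1:]" I] degree_root_poly[of I e]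
  by (simp add: root_poly_def)

lemma root_poly_dvd:
  assumes "finite I" "inj_on e I" "\<And>i. i \<in> I \<Longrightarrow> poly F (e i) = 0"
  shows "root_poly e I dvd F"
  using assms
proof (induction I arbitrary: F rule: finite_induct)
  case empty
  then show ?case by (simp add: root_poly_def)
next
  case (insert a I)
  have "[:- e a, 1:] dvd F"
    using insert.prems by (simp add: poly_eq_0_iff_dvd)
  then obtain G where G: "F = [:- e a, 1:] * G" by (elim dvdE)
  have "poly G (e i) = 0" if "i \<in> I" for i
  proof -
    have "e i \<noteq> e a" using insert.prems(1) insert.hyps that by (auto simp: inj_on_def)
    moreover have "poly F (e i) = 0" using insert.prems(2) that by auto
    ultimately show ?thesis by (simp add: G)
  qed
  then have "root_poly e I dvd G"
    using insert by (auto simp: inj_on_def)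
  then show ?case
    using insert.hyps by (simp add: root_poly_def G mult_dvd_mono del: mult_pCons_left)
qed

lemma root_poly_dvd_imp_zero:
  assumes "finite I" "root_poly e I dvd F" "degree F < card I"
  shows "F = 0"
  using assms dvd_imp_degree_le[of "root_poly e I" F] by fastforce

text \<open>Newton interpolation: a multiple of \<open>root_poly e I\<close>, which vanishes at the
  old nodes, corrects the value at the new one. The case \<open>A = 0\<close> is listed because no
  degree is below the cardinality of the empty set.\<close>

lemma interpolation:
  fixes f e :: "'i \<Rightarrow> 'a::field_char_0"
  assumes "finite I" "inj_on e I"
  shows "\<exists>A. (\<forall>i\<in>I. poly A (e i) = f i) \<and> (A = 0 \<or> degree A < card I)"
  using assms
proof (induction I rule: finite_induct)
  case empty
  then show ?case by auto
next
  case (insert a I)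
  then obtain A where A: "\<forall>i\<in>I. poly A (e i) = f i" "A = 0 \<or> degree A < card I"
    by (auto simp: inj_on_def)
  define k where "k = (f a - poly A (e a)) / poly (root_poly e I) (e a)"
  have nz: "poly (root_poly e I) (e a) \<noteq> 0"
    using insert by (auto simp: poly_root_poly)
  define B where "B = A + Polynomial.smult k (root_poly e I)"
  have "poly B (e i) = f i" if "i \<in> insert a I" for i
  proof (cases "i = a")
    case True
    then show ?thesis using nz by (simp add: B_def k_def)
  next
    case False
    then have "poly (root_poly e I) (e i) = 0" "i \<in> I"
      using that insert.hyps by (auto simp: poly_root_poly_0_iff)
    then show ?thesis using A by (simp add: B_def)
  qed
  moreover have "degree B \<le> card I"
    unfolding B_def using A insert.hyps
    by (intro degree_add_le) (auto intro: order.trans[OF degree_smult_le])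
  ultimately show ?case
    using insert.hyps by (intro exI[of _ B]) auto
qed

lemma pderiv_root_poly: "pderiv (root_poly e I) = weight_poly (\<lambda>_. 1) e I"
  by (simp add: root_poly_def weight_poly_def pderiv_prod pderiv_pCons)

text \<open>At \<open>e i\<close> only the summand of index \<open>i\<close> can survive. Comparison
  with unit weights shows that at a simple root the residue of
  \<open>weight_poly / root_poly\<close> is \<open>l i\<close>.\<close>

lemma poly_weight_poly:
  assumes "finite I" "i \<in> I"
  shows "poly (weight_poly l e I) (e i) = l i * poly (pderiv (root_poly e I)) (e i)"
proof -
  have *: "poly (weight_poly m e I) (e i) = m i * poly (root_poly e (I - {i})) (e i)" for m
  proof -
    have "poly (weight_poly m e I) (e i)
        = (\<Sum>j\<in>I. m j * poly (root_poly e (I - {j})) (e i))"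
      by (simp add: weight_poly_def poly_sum)
    also have "\<dots> = (\<Sum>j\<in>{i}. m j * poly (root_poly e (I - {j})) (e i))"
      by (rule sum.mono_neutral_right) (use assms in \<open>auto simp: poly_root_poly_0_iff\<close>)
    finally show ?thesis by simp
  qed
  show ?thesis by (simp add: pderiv_root_poly *)
qed

lemma poly_pderiv_root_poly_nonzero:
  assumes "finite I" "inj_on e I" "i \<in> I"
  shows "poly (pderiv (root_poly e I)) (e i) \<noteq> 0"
proof -
  have "poly (pderiv (root_poly e I)) (e i) = poly (root_poly e (I - {i})) (e i)"
  proof -
    have "root_poly e I = [:- e i, 1:] * root_poly e (I - {i})"
      unfolding root_poly_def using assms by (intro prod.remove)
    then show ?thesis by (simp add: pderiv_mult pderiv_pCons del: mult_pCons_left)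
  qed
  then show ?thesis
    using assms by (auto simp: poly_root_poly_0_iff inj_on_def)
qed

lemma degree_weight_poly_le:
  assumes "finite I"
  shows "degree (weight_poly l e I) \<le> card I - 1"
  unfolding weight_poly_def using assms
  by (intro degree_sum_le) (auto intro!: order.trans[OF degree_smult_le])

lemma coeff_weight_poly:
  assumes "finite I"
  shows "coeff (weight_poly l e I) (card I - 1) = sum l I"
proof -
  have "coeff (root_poly e (I - {i})) (card I - 1) = 1" if "i \<in> I" for i
    using coeff_root_poly[of "I - {i}" e] assms that by simp
  then show ?thesis by (simp add: weight_poly_def coeff_sum)
qed

section \<open>Twisted derivatives near the poles and at infinity\<close>

lemma twisted_num_add:
  "twisted_num l e I n (A + B) = twisted_num l e I n A + twisted_num l e I n B"
  by (simp add: twisted_num_def pderiv_add algebra_simps)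

text \<open>The term with \<open>pderiv A\<close> vanishes at a root. What remains shows that the
  pole order really goes up at a simple root as long as \<open>l i - n\<close> and \<open>A\<close>
  are nonzero there.\<close>

lemma poly_twisted_num:
  assumes "finite I" "i \<in> I"
  shows "poly (twisted_num l e I n A) (e i)
    = poly A (e i) * ((l i - of_nat n) * poly (pderiv (root_poly e I)) (e i))"
proof -
  have "poly (root_poly e I) (e i) = 0" using assms by (auto simp: poly_root_poly_0_iff)
  then show ?thesis
    by (simp add: twisted_num_def poly_weight_poly[OF assms] algebra_simps)
qed

text \<open>\<open>A / q ^ n\<close> and \<open>q A / q ^ (n + 1)\<close> are the same function;
  comparing the two numerators of its twisted derivative leaves one factor \<open>q\<close>.\<close>

lemma twisted_num_Suc:
  "twisted_num l e I (Suc n) (root_poly e I * A) = root_poly e I * twisted_num l e I n A"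
  by (simp add: twisted_num_def pderiv_mult algebra_simps)

lemma degree_twisted_num_le:
  assumes "finite I" "I \<noteq> {}" "degree A \<le> d"
  shows "degree (twisted_num l e I 0 A) \<le> d + (card I - 1)"
proof -
  have "degree (pderiv A * root_poly e I) \<le> d + (card I - 1)"
  \<comment> \<open>For constant \<open>A\<close> the truncated \<open>degree A - 1\<close> would
    spoil the bound, but then the product is zero.\<close>
  proof (cases "degree A = 0")
    case True
    then have "pderiv A = 0" by (simp add: pderiv_eq_0_iff)
    then show ?thesis by simp
  next
    case False
    have "degree (pderiv A * root_poly e I) \<le> (degree A - 1) + card I"
      using degree_mult_le[of "pderiv A" "root_poly e I"] assms by (simp add: degree_pderiv)
    then show ?thesis using False assms by auto
  qed
  moreover have "degree (A * weight_poly l e I) \<le> d + (card I - 1)"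
    using degree_mult_le[of A "weight_poly l e I"] degree_weight_poly_le[of I l e] assms by auto
  ultimately show ?thesis
    by (simp add: twisted_num_def degree_add_le)
qed

text \<open>A leading term \<open>x ^ d\<close> contributes \<open>d\<close> through its derivative
  and \<open>sum l I\<close> through the top coefficient of \<open>weight_poly\<close>.\<close>

lemma coeff_twisted_num:
  assumes "finite I" "I \<noteq> {}" "degree A \<le> d"
  shows "coeff (twisted_num l e I 0 A) (d + (card I - 1)) = (of_nat d + sum l I) * coeff A d"
proof -
  have "coeff (pderiv A * root_poly e I) (d + (card I - 1)) = of_nat d * coeff A d"
  proof (cases d)
    case 0
    then have "pderiv A = 0" using assms by (simp add: pderiv_eq_0_iff)
    then show ?thesis using 0 by simp
  next
    case (Suc d')
    have "card I > 0" using assms by (simp add: card_gt_0_iff)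
    then have "d + (card I - 1) = d' + card I" using Suc by simp
    moreover have "coeff (pderiv A * root_poly e I) (d' + card I) = coeff (pderiv A) d'"
      using coeff_mult_add[of "pderiv A" d' "root_poly e I" "card I"] assms Suc
      by (simp add: degree_pderiv)
    ultimately show ?thesis using Suc by (simp add: coeff_pderiv)
  qed
  moreover have "coeff (A * weight_poly l e I) (d + (card I - 1)) = coeff A d * sum l I"
    using coeff_mult_add[of A d "weight_poly l e I" "card I - 1"] assms degree_weight_poly_le[of I l e]
    by (simp add: coeff_weight_poly del: One_nat_def)
  ultimately show ?thesis by (simp add: twisted_num_def algebra_simps)
qed

text \<open>The factors to be kept nonzero are \<open>l i - n\<close> and \<open>d + sum l I\<close>
  with an exponent \<open>n\<close> and a degree \<open>d\<close>, hence conditions on \<nat>.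
  \<open>J\<close> marks the points at which the remainders have no pole.\<close>

locale generic_weights =
  fixes I :: "'i set" and e l :: "'i \<Rightarrow> 'a::field_char_0" and J :: "'i set"
  assumes finite_I: "finite I" and inj_e: "inj_on e I"
    and weight_not_nat: "\<And>i. i \<in> I \<Longrightarrow> l i \<notin> \<nat>"
    and sum_not_nat: "- sum l I \<notin> \<nat>"
    and J_sub: "J \<subseteq> I" and J_nonempty: "J \<noteq> {}"
begin

lemma finite_J: "finite J" and inj_J: "inj_on e J" and I_nonempty: "I \<noteq> {}"
  using finite_I inj_e J_sub J_nonempty by (auto intro: finite_subset inj_on_subset)

lemma factor_nonzero:
  assumes "i \<in> I"
  shows "(l i - of_nat n) * poly (pderiv (root_poly e I)) (e i) \<noteq> 0"
  using weight_not_nat[OF assms] poly_pderiv_root_poly_nonzero[OF finite_I inj_e assms] by auto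

lemma top_factor_nonzero: "of_nat d + sum l I \<noteq> 0"
  using sum_not_nat by (metis minus_unique add.commute of_nat_in_Nats)

text \<open>Comparing the coefficients of the poles, \<open>A\<close> vanishes at every root if \<open>n > 0\<close>, which lowers \<open>n\<close>;
  if \<open>n = 0\<close>, it vanishes at \<open>J\<close>, whereas the growth at infinity gives \<open>degree A < card J\<close>.\<close>

lemma remainder_unique:
  assumes "twisted_num l e I n A = S * root_poly e J * root_poly e I ^ n" "degree S + 2 \<le> card I"
  shows "S = 0"
  using assms(1)
proof (induction n arbitrary: A)
  case 0
  have "poly A (e i) = 0" if "i \<in> J" for i
  proof -
    have "poly (S * root_poly e J) (e i) = 0" using that finite_J by (auto simp: poly_root_poly_0_iff)
    then show ?thesis
      using poly_twisted_num[OF finite_I, of i l e 0 A] that J_sub factor_nonzero[of i 0] 0 by auto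
  qed
  then have dvd: "root_poly e J dvd A" by (intro root_poly_dvd finite_J inj_J)
  have "A = 0"
  proof (rule ccontr)
    \<comment> \<open>The left side has degree at least \<open>degree A + (card I - 1)\<close>, the
      right side at most \<open>degree S + card J\<close>; so \<open>A\<close> has degree below
      \<open>card J\<close>, too small for a nonzero multiple of
      \<open>root_poly e J\<close>.\<close>
    assume "A \<noteq> 0"
    then have "coeff (twisted_num l e I 0 A) (degree A + (card I - 1)) \<noteq> 0"
      using coeff_twisted_num[OF finite_I I_nonempty order.refl, of l e A] top_factor_nonzero
        \<open>A \<noteq> 0\<close> by simp
    then have "degree A + (card I - 1) \<le> degree (S * root_poly e J)"
      using 0 by (simp add: le_degree)
    also have "\<dots> \<le> degree S + card J"
      using degree_mult_le[of S "root_poly e J"] finite_J by simp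
    finally have "degree A < card J" using assms(2) by simp
    then show False using root_poly_dvd_imp_zero[OF finite_J dvd] \<open>A \<noteq> 0\<close> by simp
  qed
  then show ?case using 0 finite_J by (simp add: twisted_num_def)
next
  case (Suc n)
  have "poly A (e i) = 0" if "i \<in> I" for i
  proof -
    have "poly (S * root_poly e J * root_poly e I ^ Suc n) (e i) = 0"
      using that finite_I by (auto simp: poly_root_poly_0_iff)
    then show ?thesis
      using poly_twisted_num[OF finite_I that, of l e "Suc n" A] factor_nonzero[OF that, of "Suc n"]
        Suc.prems by auto
  qed
  then have "root_poly e I dvd A" by (intro root_poly_dvd finite_I inj_e)
  then obtain B where B: "A = root_poly e I * B" by (elim dvdE)
  have "root_poly e I * twisted_num l e I n B = twisted_num l e I (Suc n) A"
    by (simp only: B twisted_num_Suc)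
  also have "\<dots> = root_poly e I * (S * root_poly e J * root_poly e I ^ n)"
    using Suc.prems by (simp add: mult_ac)
  finally have "root_poly e I * twisted_num l e I n B
      = root_poly e I * (S * root_poly e J * root_poly e I ^ n)" .
  then show ?case using Suc.IH finite_I by simp
qed

text \<open>Induction on the degree: an \<open>H\<close> of large degree loses its leading term to
  the image of a monomial; one of small degree is made to vanish on \<open>J\<close> by
  interpolation, and then \<open>root_poly e J\<close> splits off.\<close>

lemma remainder_exists_polynomial:
  "\<exists>A S. H = twisted_num l e I 0 A + S * root_poly e J \<and> degree S \<le> card I - 2"
proof (induction "degree H" arbitrary: H rule: less_induct)
  case less
  have cI: "card I > 0" and cJ: "card J > 0"
    using I_nonempty finite_I J_nonempty finite_J by (auto simp: card_gt_0_iff)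
  show ?case
  proof (cases "degree H \<ge> card I - 1 + card J")
    case True
    \<comment> \<open>The image of a monomial of degree \<open>d\<close> has the degree of
      \<open>H\<close>.\<close>
    define d where "d = degree H - (card I - 1)"
    have d: "degree H = d + (card I - 1)" and pos: "degree H > 0" using True cJ by (auto simp: d_def)
    define M where "M = Polynomial.monom (lead_coeff H / (of_nat d + sum l I)) d"
    have degM: "degree M \<le> d" by (simp add: M_def degree_monom_le)
    define H' where "H' = H - twisted_num l e I 0 M"
    have "coeff H' (d + (card I - 1)) = coeff H (degree H) - (of_nat d + sum l I) * coeff M d"
      using coeff_twisted_num[OF finite_I I_nonempty degM, of l e]
      by (simp only: H'_def coeff_diff d)
    then have "coeff H' (degree H) = 0"
      using top_factor_nonzero[of d] by (simp add: M_def d)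
    moreover have "degree H' \<le> degree H"
      using degree_twisted_num_le[OF finite_I I_nonempty degM, of l e]
      unfolding d H'_def by (intro degree_diff_le) (simp_all only: d order.refl)
    \<comment> \<open>The drop is strict because \<open>degree H\<close> is positive; the zero
      polynomial also has degree 0.\<close>
    ultimately have "degree H' < degree H"
      using pos by (metis degree_0 leading_coeff_0_iff le_neq_implies_less)
    then obtain A S where "H' = twisted_num l e I 0 A + S * root_poly e J" "degree S \<le> card I - 2"
      using less by blast
    then show ?thesis
      by (intro exI[of _ "M + A"] exI[of _ S]) (auto simp: H'_def twisted_num_add algebra_simps)
  next
    case False
    obtain A where A: "\<forall>i\<in>J. poly A (e i)
          = poly H (e i) / (l i * poly (pderiv (root_poly e I)) (e i))"
        "A = 0 \<or> degree A < card J"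
      using interpolation[OF finite_J inj_J, of "\<lambda>i. poly H (e i) /
        (l i * poly (pderiv (root_poly e I)) (e i))"] by blast
    define F where "F = H - twisted_num l e I 0 A"
    have "poly F (e i) = 0" if "i \<in> J" for i
      using poly_twisted_num[OF finite_I, of i l e 0 A] A(1) that J_sub factor_nonzero[of i 0]
      by (auto simp: F_def)
    then have "root_poly e J dvd F" by (intro root_poly_dvd finite_J inj_J)
    then obtain S where S: "F = root_poly e J * S" by (elim dvdE)
    have "degree A \<le> card J - 1" using A(2) by auto
    then have "degree F \<le> card J - 1 + (card I - 1)"
      unfolding F_def using False cI cJ
      by (intro degree_diff_le degree_twisted_num_le finite_I I_nonempty) auto
    \<comment> \<open>\<open>F\<close> has degree at most \<open>card J + card I - 2\<close>, of
      which \<open>root_poly e J\<close> takes \<open>card J\<close>.\<close>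
    then have "degree S \<le> card I - 2"
      using finite_J cI cJ by (cases "S = 0") (auto simp: S degree_mult_eq)
    moreover have "H = twisted_num l e I 0 A + S * root_poly e J"
      using S by (simp add: F_def algebra_simps)
    ultimately show ?thesis by blast
  qed
qed

text \<open>Each step interpolates on all of \<open>I\<close> to cancel the poles of highest order,
  divides by \<open>root_poly e I\<close> and continues with a smaller \<open>n\<close>.\<close>

lemma remainder_exists:
  "\<exists>A S. H = twisted_num l e I n A + S * root_poly e J * root_poly e I ^ n \<and> degree S \<le> card I - 2"
proof (induction n arbitrary: H)
  case 0
  then show ?case using remainder_exists_polynomial by simp
next
  case (Suc n)
  obtain A where A: "\<forall>i\<in>I. poly A (e i)
      = poly H (e i) / ((l i - of_nat (Suc n)) * poly (pderiv (root_poly e I)) (e i))"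
    using interpolation[OF finite_I inj_e, of "\<lambda>i. poly H (e i) /
      ((l i - of_nat (Suc n)) * poly (pderiv (root_poly e I)) (e i))"] by blast
  define F where "F = H - twisted_num l e I (Suc n) A"
  have "poly F (e i) = 0" if "i \<in> I" for i
    using poly_twisted_num[OF finite_I that, of l e "Suc n" A] A that factor_nonzero[OF that, of "Suc n"]
    by (auto simp: F_def)
  then have "root_poly e I dvd F" by (intro root_poly_dvd finite_I inj_e)
  then obtain G where G: "F = root_poly e I * G" by (elim dvdE)
  obtain B S where B: "G = twisted_num l e I n B + S * root_poly e J * root_poly e I ^ n"
      and S: "degree S \<le> card I - 2"
    using Suc by blast
  have "H = twisted_num l e I (Suc n) A + root_poly e I * G"
    using G by (metis F_def diff_eq_eq add.commute)
  \<comment> \<open>By \<open>twisted_num_Suc\<close> the correction \<open>B\<close> at exponent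
    \<open>n\<close> is the correction \<open>root_poly e I * B\<close> at \<open>Suc n\<close>, so
    it merges with \<open>A\<close>.\<close>
  also have "\<dots> = twisted_num l e I (Suc n) (A + root_poly e I * B)
      + S * root_poly e J * root_poly e I ^ Suc n"
    unfolding B twisted_num_add twisted_num_Suc by (simp add: algebra_simps)
  finally show ?case using S by blast
qed

end

section \<open>Bases of quotient modules and of eigenspaces in them\<close>

locale quotient_module = module R M for R (structure) and M (structure) +
  fixes N
  assumes submodule: "submodule N R M"
begin

sublocale abelian_subgroup N M
  using submodule by (intro abelian_subgroupI3 additive_subgroup.intro submodule.axioms(1) abelian_group_axioms)

section \<open>Arithmetic of cosets\<close>

lemma coset_eq_iff:
  assumes "x \<in> carrier M" "y \<in> carrier M"
  shows "N +>\<^bsub>M\<^esub> x = N +>\<^bsub>M\<^esub> y \<longleftrightarrow> x \<ominus>\<^bsub>M\<^esub> y \<in> N"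
proof
  assume "N +>\<^bsub>M\<^esub> x = N +>\<^bsub>M\<^esub> y"
  then have "x \<in> N +>\<^bsub>M\<^esub> y" using assms(1) a_rcos_self by blast
  then show "x \<ominus>\<^bsub>M\<^esub> y \<in> N" using assms(2) a_rcos_module_imp by (simp add: a_minus_def)
next
  assume "x \<ominus>\<^bsub>M\<^esub> y \<in> N"
  then have "x \<in> N +>\<^bsub>M\<^esub> y" using assms a_rcos_module_rev by (simp add: a_minus_def)
  then show "N +>\<^bsub>M\<^esub> x = N +>\<^bsub>M\<^esub> y" using a_repr_independence' assms(2) by blast
qed

text \<open>In \<open>quot_module\<close> the scalar multiple is a union over all representatives;
  they all give the same coset, so the union collapses.\<close>

lemma quot_smult:
  assumes "a \<in> carrier R" "x \<in> carrier M"
  shows "a \<odot>\<^bsub>quot_module M N\<^esub> (N +>\<^bsub>M\<^esub> x) = N +>\<^bsub>M\<^esub> (a \<odot>\<^bsub>M\<^esub> x)"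
proof -
  have "N +>\<^bsub>M\<^esub> (a \<odot>\<^bsub>M\<^esub> y) = N +>\<^bsub>M\<^esub> (a \<odot>\<^bsub>M\<^esub> x)" if y: "y \<in> N +>\<^bsub>M\<^esub> x" for y
  proof -
    have yM: "y \<in> carrier M" using a_elemrcos_carrier assms y by blast
    have "y \<ominus>\<^bsub>M\<^esub> x \<in> N" using a_rcos_module_imp assms y by (simp add: a_minus_def)
    then have "a \<odot>\<^bsub>M\<^esub> (y \<ominus>\<^bsub>M\<^esub> x) \<in> N" using submoduleE(4)[OF submodule] assms by blast
    then have "(a \<odot>\<^bsub>M\<^esub> y) \<ominus>\<^bsub>M\<^esub> (a \<odot>\<^bsub>M\<^esub> x) \<in> N"
      using assms yM by (simp add: a_minus_def smult_r_distr smult_r_minus)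
    then show ?thesis using coset_eq_iff assms yM by simp
  qed
  moreover have "x \<in> N +>\<^bsub>M\<^esub> x" using a_rcos_self assms by blast
  ultimately have "(\<Union>y\<in>N +>\<^bsub>M\<^esub> x. N +>\<^bsub>M\<^esub> (a \<odot>\<^bsub>M\<^esub> y)) = N +>\<^bsub>M\<^esub> (a \<odot>\<^bsub>M\<^esub> x)"
    by (intro UN_constant_eq) blast+
  then show ?thesis unfolding quot_module_def by simp
qed

lemma carrier_quot_module: "carrier (quot_module M N) = (\<lambda>x. N +>\<^bsub>M\<^esub> x) ` carrier M"
  by (auto simp: quot_module_def A_RCOSETS_def RCOSETS_def a_r_coset_def)

section \<open>Cosets represented in a submodule\<close>

context
  fixes V Q
  assumes V: "submodule V R M"
    and Q: "Q = (quot_module M N)\<lparr>carrier := (\<lambda>x. N +>\<^bsub>M\<^esub> x) ` V\<rparr>"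
begin

lemma V_sub: "x \<in> V \<Longrightarrow> x \<in> carrier M"
  using submoduleE(1)[OF V] by blast

lemma V_zero: "\<zero>\<^bsub>M\<^esub> \<in> V"
  using subgroup.one_closed[OF submodule.axioms(1)[OF V]] by simp

lemma coset_in_carrier: "x \<in> V \<Longrightarrow> N +>\<^bsub>M\<^esub> x \<in> carrier Q"
  by (auto simp: Q)

lemma zero_coset: "\<zero>\<^bsub>Q\<^esub> = N +>\<^bsub>M\<^esub> \<zero>\<^bsub>M\<^esub>"
  using a_rcos_const[OF additive_subgroup.zero_closed[OF is_additive_subgroup]]
  by (simp add: Q quot_module_def)

lemma add_cosets:
  "x \<in> V \<Longrightarrow> y \<in> V \<Longrightarrow> (N +>\<^bsub>M\<^esub> x) \<oplus>\<^bsub>Q\<^esub> (N +>\<^bsub>M\<^esub> y) = N +>\<^bsub>M\<^esub> (x \<oplus>\<^bsub>M\<^esub> y)"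
  using V_sub by (simp add: Q quot_module_def a_rcos_sum)

lemma smult_coset: "a \<in> carrier R \<Longrightarrow> x \<in> V \<Longrightarrow> a \<odot>\<^bsub>Q\<^esub> (N +>\<^bsub>M\<^esub> x) = N +>\<^bsub>M\<^esub> (a \<odot>\<^bsub>M\<^esub> x)"
  using V_sub quot_smult by (simp add: Q)

lemma abelian_monoid_Q: "abelian_monoid Q"
proof (rule abelian_monoidI)
  have carr: "A \<in> carrier Q \<longleftrightarrow> (\<exists>x\<in>V. A = N +>\<^bsub>M\<^esub> x)" for A by (auto simp: Q)
  note E = submoduleE(5)[OF V]
  show "x \<oplus>\<^bsub>Q\<^esub> y \<in> carrier Q" if "x \<in> carrier Q" "y \<in> carrier Q" for x y
    using that E by (auto simp: carr add_cosets)
  show "\<zero>\<^bsub>Q\<^esub> \<in> carrier Q" using V_zero by (auto simp: carr zero_coset)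
  show "x \<oplus>\<^bsub>Q\<^esub> y \<oplus>\<^bsub>Q\<^esub> w = x \<oplus>\<^bsub>Q\<^esub> (y \<oplus>\<^bsub>Q\<^esub> w)"
    if "x \<in> carrier Q" "y \<in> carrier Q" "w \<in> carrier Q" for x y w
    using that E V_sub by (auto simp: carr add_cosets M.a_assoc)
  show "\<zero>\<^bsub>Q\<^esub> \<oplus>\<^bsub>Q\<^esub> x = x" if "x \<in> carrier Q" for x
    using that V_zero V_sub by (auto simp: carr zero_coset add_cosets)
  show "x \<oplus>\<^bsub>Q\<^esub> y = y \<oplus>\<^bsub>Q\<^esub> x" if "x \<in> carrier Q" "y \<in> carrier Q" for x y
    using that V_sub by (auto simp: carr add_cosets M.a_comm)
qed

lemma finsum_cosets:
  assumes "finite I" "v \<in> I \<rightarrow> V"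
  shows "(\<Oplus>\<^bsub>M\<^esub>i\<in>I. v i) \<in> V \<and> (\<Oplus>\<^bsub>Q\<^esub>i\<in>I. N +>\<^bsub>M\<^esub> v i) = N +>\<^bsub>M\<^esub> (\<Oplus>\<^bsub>M\<^esub>i\<in>I. v i)"
  using assms
proof (induction I rule: finite_induct)
  case empty
  interpret Q: abelian_monoid Q by (rule abelian_monoid_Q)
  show ?case using V_zero by (simp add: zero_coset)
next
  case (insert j I)
  interpret Q: abelian_monoid Q by (rule abelian_monoid_Q)
  have v: "v j \<in> V" "v \<in> I \<rightarrow> V" using insert.prems by auto
  then have "v \<in> I \<rightarrow> carrier M" "v j \<in> carrier M" using V_sub by auto
  then have "(\<Oplus>\<^bsub>M\<^esub>i\<in>insert j I. v i) = v j \<oplus>\<^bsub>M\<^esub> (\<Oplus>\<^bsub>M\<^esub>i\<in>I. v i)"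
    using insert.hyps by (simp add: M.finsum_insert)
  moreover have "(\<Oplus>\<^bsub>Q\<^esub>i\<in>insert j I. N +>\<^bsub>M\<^esub> v i) = (N +>\<^bsub>M\<^esub> v j) \<oplus>\<^bsub>Q\<^esub> (\<Oplus>\<^bsub>Q\<^esub>i\<in>I. N +>\<^bsub>M\<^esub> v i)"
    using insert.hyps v coset_in_carrier by (intro Q.finsum_insert) auto
  ultimately show ?case
    using insert.IH[OF v(2)] v submoduleE(5)[OF V] by (simp add: add_cosets)
qed

text \<open>A linear combination of cosets is the coset of the linear combination, so vanishing and
  equality in \<open>Q\<close> become membership in \<open>N\<close>. With a general
  \<open>V\<close> this serves the whole quotient and the eigenspaces alike.\<close>

lemma module_basis_cosetsI:
  assumes "finite I" "v \<in> I \<rightarrow> V"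
    and indep: "\<And>a. a \<in> I \<rightarrow> carrier R \<Longrightarrow> (\<Oplus>\<^bsub>M\<^esub>i\<in>I. a i \<odot>\<^bsub>M\<^esub> v i) \<in> N \<Longrightarrow> \<forall>i\<in>I. a i = \<zero>"
    and span: "\<And>x. x \<in> V \<Longrightarrow> \<exists>a \<in> I \<rightarrow> carrier R. x \<ominus>\<^bsub>M\<^esub> (\<Oplus>\<^bsub>M\<^esub>i\<in>I. a i \<odot>\<^bsub>M\<^esub> v i) \<in> N"
  shows "module_basis R Q I (\<lambda>i. N +>\<^bsub>M\<^esub> v i)"
proof -
  interpret Q: abelian_monoid Q by (rule abelian_monoid_Q)
  have *: "(\<Oplus>\<^bsub>M\<^esub>i\<in>I. a i \<odot>\<^bsub>M\<^esub> v i) \<in> V"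
    "(\<Oplus>\<^bsub>Q\<^esub>i\<in>I. a i \<odot>\<^bsub>Q\<^esub> (N +>\<^bsub>M\<^esub> v i)) = N +>\<^bsub>M\<^esub> (\<Oplus>\<^bsub>M\<^esub>i\<in>I. a i \<odot>\<^bsub>M\<^esub> v i)"
    if a: "a \<in> I \<rightarrow> carrier R" for a
  proof -
    have av: "(\<lambda>i. a i \<odot>\<^bsub>M\<^esub> v i) \<in> I \<rightarrow> V"
      using a assms(2) submoduleE(4)[OF V] by auto
    have "(\<Oplus>\<^bsub>Q\<^esub>i\<in>I. a i \<odot>\<^bsub>Q\<^esub> (N +>\<^bsub>M\<^esub> v i)) = (\<Oplus>\<^bsub>Q\<^esub>i\<in>I. N +>\<^bsub>M\<^esub> (a i \<odot>\<^bsub>M\<^esub> v i))"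
      using a assms(2) av coset_in_carrier by (intro Q.finsum_cong') (auto simp: smult_coset Pi_iff)
    then show "(\<Oplus>\<^bsub>M\<^esub>i\<in>I. a i \<odot>\<^bsub>M\<^esub> v i) \<in> V"
      "(\<Oplus>\<^bsub>Q\<^esub>i\<in>I. a i \<odot>\<^bsub>Q\<^esub> (N +>\<^bsub>M\<^esub> v i)) = N +>\<^bsub>M\<^esub> (\<Oplus>\<^bsub>M\<^esub>i\<in>I. a i \<odot>\<^bsub>M\<^esub> v i)"
      using finsum_cosets[OF assms(1) av] by auto
  qed
  show ?thesis
    unfolding module_basis_def
  proof (intro conjI ballI impI)
    show "finite I" by fact
    show "(\<lambda>i. N +>\<^bsub>M\<^esub> v i) \<in> I \<rightarrow> carrier Q" using assms(2) coset_in_carrier by auto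
    show "a i = \<zero>"
      if a: "a \<in> I \<rightarrow> carrier R" and 0: "(\<Oplus>\<^bsub>Q\<^esub>i\<in>I. a i \<odot>\<^bsub>Q\<^esub> (N +>\<^bsub>M\<^esub> v i)) = \<zero>\<^bsub>Q\<^esub>" and "i \<in> I" for a i
    proof -
      have "(\<Oplus>\<^bsub>M\<^esub>i\<in>I. a i \<odot>\<^bsub>M\<^esub> v i) \<ominus>\<^bsub>M\<^esub> \<zero>\<^bsub>M\<^esub> \<in> N"
        using coset_eq_iff 0 * [OF a] V_sub by (metis M.zero_closed zero_coset)
      moreover have "\<ominus>\<^bsub>M\<^esub> \<zero>\<^bsub>M\<^esub> = \<zero>\<^bsub>M\<^esub>" by (rule M.minus_equality) auto
      ultimately show ?thesis
        using indep[OF a] that *(1)[OF a] V_sub by (simp add: a_minus_def)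
    qed
    show "\<exists>a\<in>I \<rightarrow> carrier R. A = (\<Oplus>\<^bsub>Q\<^esub>i\<in>I. a i \<odot>\<^bsub>Q\<^esub> (N +>\<^bsub>M\<^esub> v i))" if "A \<in> carrier Q" for A
    proof -
      have "A \<in> (\<lambda>x. N +>\<^bsub>M\<^esub> x) ` V" using that by (simp add: Q)
      then obtain x where x: "x \<in> V" "A = N +>\<^bsub>M\<^esub> x" by blast
      then obtain a where a: "a \<in> I \<rightarrow> carrier R" "x \<ominus>\<^bsub>M\<^esub> (\<Oplus>\<^bsub>M\<^esub>i\<in>I. a i \<odot>\<^bsub>M\<^esub> v i) \<in> N"
        using span by blast
      then have "A = (\<Oplus>\<^bsub>Q\<^esub>i\<in>I. a i \<odot>\<^bsub>Q\<^esub> (N +>\<^bsub>M\<^esub> v i))"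
        using x * [OF a(1)] V_sub coset_eq_iff by simp
      then show ?thesis using a by blast
    qed
  qed
qed

end

lemma module_basis_quotI:
  assumes "finite I" "v \<in> I \<rightarrow> carrier M"
    and "\<And>a. a \<in> I \<rightarrow> carrier R \<Longrightarrow> (\<Oplus>\<^bsub>M\<^esub>i\<in>I. a i \<odot>\<^bsub>M\<^esub> v i) \<in> N \<Longrightarrow> \<forall>i\<in>I. a i = \<zero>"
    and "\<And>x. x \<in> carrier M \<Longrightarrow> \<exists>a \<in> I \<rightarrow> carrier R. x \<ominus>\<^bsub>M\<^esub> (\<Oplus>\<^bsub>M\<^esub>i\<in>I. a i \<odot>\<^bsub>M\<^esub> v i) \<in> N"
  shows "module_basis R (quot_module M N) I (\<lambda>i. N +>\<^bsub>M\<^esub> v i)"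
proof (rule module_basis_cosetsI[OF carrier_is_submodule _ assms])
  show "quot_module M N = quot_module M N\<lparr>carrier := (\<lambda>x. N +>\<^bsub>M\<^esub> x) ` carrier M\<rparr>"
    by (simp flip: carrier_quot_module)
qed

text \<open>The coset of \<open>x\<close> lies in the eigenspace exactly if \<open>f x\<close> and
  \<open>s x\<close> agree modulo \<open>N\<close>. Such \<open>x\<close> form a submodule
  \<open>V\<close>, to which \<open>module_basis_cosetsI\<close> applies.\<close>

lemma module_basis_eigenspaceI:
  assumes f: "\<And>x. x \<in> carrier M \<Longrightarrow> f x \<in> carrier M"
      "\<And>x y. x \<in> carrier M \<Longrightarrow> y \<in> carrier M \<Longrightarrow> f (x \<oplus>\<^bsub>M\<^esub> y) = f x \<oplus>\<^bsub>M\<^esub> f y"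
      "\<And>a x. a \<in> carrier R \<Longrightarrow> x \<in> carrier M \<Longrightarrow> f (a \<odot>\<^bsub>M\<^esub> x) = a \<odot>\<^bsub>M\<^esub> f x"
      "f ` N = N"
    and s: "s \<in> carrier R"
    and I: "finite I" and v: "v \<in> I \<rightarrow> carrier M" "\<And>i. i \<in> I \<Longrightarrow> f (v i) \<ominus>\<^bsub>M\<^esub> s \<odot>\<^bsub>M\<^esub> v i \<in> N"
    and indep: "\<And>a. a \<in> I \<rightarrow> carrier R \<Longrightarrow> (\<Oplus>\<^bsub>M\<^esub>i\<in>I. a i \<odot>\<^bsub>M\<^esub> v i) \<in> N \<Longrightarrow> \<forall>i\<in>I. a i = \<zero>"
    and span: "\<And>x. x \<in> carrier M \<Longrightarrow> f x \<ominus>\<^bsub>M\<^esub> s \<odot>\<^bsub>M\<^esub> x \<in> N \<Longrightarrow>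
       \<exists>a \<in> I \<rightarrow> carrier R. x \<ominus>\<^bsub>M\<^esub> (\<Oplus>\<^bsub>M\<^esub>i\<in>I. a i \<odot>\<^bsub>M\<^esub> v i) \<in> N"
  shows "module_basis R ((quot_module M N)\<lparr>carrier :=
       {A \<in> carrier (quot_module M N). f ` A = s \<odot>\<^bsub>quot_module M N\<^esub> A}\<rparr>) I (\<lambda>i. N +>\<^bsub>M\<^esub> v i)"
proof -
  define V where "V = {x \<in> carrier M. f x \<ominus>\<^bsub>M\<^esub> s \<odot>\<^bsub>M\<^esub> x \<in> N}"
  have N_sub: "x \<in> carrier M" if "x \<in> N" for x using submoduleE(1)[OF submodule] that by blast
  \<comment> \<open>Since \<open>f\<close> maps \<open>N\<close> onto itself, the image is a full
    coset and not just a part of one.\<close>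
  have image: "f ` (N +>\<^bsub>M\<^esub> x) = N +>\<^bsub>M\<^esub> f x" if x: "x \<in> carrier M" for x
  proof -
    have "f ` (N +>\<^bsub>M\<^esub> x) = (\<lambda>n. f n \<oplus>\<^bsub>M\<^esub> f x) ` N"
      using f(2) x N_sub by (auto simp: a_r_coset_def' image_iff)
    also have "\<dots> = (\<lambda>n. n \<oplus>\<^bsub>M\<^esub> f x) ` (f ` N)" by (simp add: image_image)
    also have "\<dots> = N +>\<^bsub>M\<^esub> f x" unfolding f(4) by (auto simp: a_r_coset_def')
    finally show ?thesis .
  qed
  have f0: "f \<zero>\<^bsub>M\<^esub> = \<zero>\<^bsub>M\<^esub>"
    using f(3)[OF R.zero_closed M.zero_closed] f(1)[OF M.zero_closed] by simp
  have V: "submodule V R M"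
  proof (rule submoduleI)
    show "V \<subseteq> carrier M" by (auto simp: V_def)
    have smult: "a \<odot>\<^bsub>M\<^esub> x \<in> V" if a: "a \<in> carrier R" and "x \<in> V" for a x
    proof -
      have x: "x \<in> carrier M" "f x \<ominus>\<^bsub>M\<^esub> s \<odot>\<^bsub>M\<^esub> x \<in> N" using that by (auto simp: V_def)
      then have "a \<odot>\<^bsub>M\<^esub> (f x \<ominus>\<^bsub>M\<^esub> s \<odot>\<^bsub>M\<^esub> x) \<in> N" using submoduleE(4)[OF submodule] a by blast
      also have "a \<odot>\<^bsub>M\<^esub> (f x \<ominus>\<^bsub>M\<^esub> s \<odot>\<^bsub>M\<^esub> x) = f (a \<odot>\<^bsub>M\<^esub> x) \<ominus>\<^bsub>M\<^esub> s \<odot>\<^bsub>M\<^esub> (a \<odot>\<^bsub>M\<^esub> x)"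
        using x a s f(1,3)
        by (simp add: a_minus_def smult_r_distr smult_r_minus flip: smult_assoc1 R.m_comm)
      finally show ?thesis using x a by (simp add: V_def)
    qed
    show "\<And>a x. a \<in> carrier R \<Longrightarrow> x \<in> V \<Longrightarrow> a \<odot>\<^bsub>M\<^esub> x \<in> V" by (rule smult)
    show "\<zero>\<^bsub>M\<^esub> \<in> V"
      using additive_subgroup.zero_closed[OF is_additive_subgroup] s by (simp add: V_def f0 a_minus_def)
    show "\<ominus>\<^bsub>M\<^esub> x \<in> V" if x: "x \<in> V" for x
    proof -
      have "\<ominus>\<^bsub>M\<^esub> x = (\<ominus> \<one>) \<odot>\<^bsub>M\<^esub> x" using x by (simp add: V_def smult_l_minus)
      then show ?thesis using smult[of "\<ominus> \<one>" x] x by simp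
    qed
    show "x \<oplus>\<^bsub>M\<^esub> y \<in> V" if "x \<in> V" "y \<in> V" for x y
    proof -
      have xy: "x \<in> carrier M" "f x \<ominus>\<^bsub>M\<^esub> s \<odot>\<^bsub>M\<^esub> x \<in> N" "y \<in> carrier M" "f y \<ominus>\<^bsub>M\<^esub> s \<odot>\<^bsub>M\<^esub> y \<in> N"
        using that by (auto simp: V_def)
      then have "(f x \<ominus>\<^bsub>M\<^esub> s \<odot>\<^bsub>M\<^esub> x) \<oplus>\<^bsub>M\<^esub> (f y \<ominus>\<^bsub>M\<^esub> s \<odot>\<^bsub>M\<^esub> y) \<in> N"
        using submoduleE(5)[OF submodule] by blast
      also have "(f x \<ominus>\<^bsub>M\<^esub> s \<odot>\<^bsub>M\<^esub> x) \<oplus>\<^bsub>M\<^esub> (f y \<ominus>\<^bsub>M\<^esub> s \<odot>\<^bsub>M\<^esub> y)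
          = f (x \<oplus>\<^bsub>M\<^esub> y) \<ominus>\<^bsub>M\<^esub> s \<odot>\<^bsub>M\<^esub> (x \<oplus>\<^bsub>M\<^esub> y)"
        using xy f(1,2) s by (simp add: a_minus_def smult_r_distr M.minus_add M.a_ac)
      finally show ?thesis using xy by (simp add: V_def)
    qed
  qed
  have "f ` (N +>\<^bsub>M\<^esub> x) = s \<odot>\<^bsub>quot_module M N\<^esub> (N +>\<^bsub>M\<^esub> x) \<longleftrightarrow> x \<in> V" if x: "x \<in> carrier M" for x
    using x s f(1) coset_eq_iff by (simp add: image quot_smult V_def)
  then have eq: "{A \<in> carrier (quot_module M N). f ` A = s \<odot>\<^bsub>quot_module M N\<^esub> A}
      = (\<lambda>x. N +>\<^bsub>M\<^esub> x) ` V"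
    unfolding carrier_quot_module by (auto simp: V_def)
  show ?thesis unfolding eq
    by (rule module_basis_cosetsI[OF V refl I _ indep]) (use v span in \<open>auto simp: V_def\<close>)
qed

end

section \<open>Regular functions on the curve\<close>

lemma quintic_root_poly: "quintic z = root_poly z {..4}"
  by (simp add: quintic_def root_poly_def)

lemma quintic_nonzero [simp]: "quintic z \<noteq> 0"
  by (simp add: quintic_root_poly)

lemma degree_quintic [simp]: "degree (quintic z) = 5"
  by (simp add: quintic_root_poly)

lemma mem_curve_iff: "(x, y) \<in> curve z \<longleftrightarrow> y\<^sup>2 = poly (quintic z) x \<and> y \<noteq> 0"
  using poly_root_poly_0_iff[of "{..4}" z x] by (auto simp: curve_def quintic_root_poly)

lemma curve_quintic_nonzero: "(x, y) \<in> curve z \<Longrightarrow> poly (quintic z) x \<noteq> 0"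
  using power_not_zero[of y 2] by (auto simp: mem_curve_iff)

lemma curve_uminus: "(x, - y) \<in> curve z \<longleftrightarrow> (x, y) \<in> curve z"
  by (simp add: mem_curve_iff)

lemma csqrt_mem_curve: "poly (quintic z) x \<noteq> 0 \<Longrightarrow> (x, csqrt (poly (quintic z) x)) \<in> curve z"
  by (simp add: mem_curve_iff)

text \<open>As \<open>y\<close> is nonzero on the curve, the tangent line is a graph over the
  \<open>x\<close>-axis. This is why every form is a function times \<open>dx\<close>.\<close>

lemma tangent_vector_iff:
  "(x, y) \<in> curve z \<Longrightarrow>
     w \<in> tangent_space z (x, y) \<longleftrightarrow> w = (fst w, poly (pderiv (quintic z)) x / (2 * y) * fst w)"
  by (cases w) (auto simp: tangent_space_def mem_curve_iff field_simps)

lemma eval2_simps [simp]: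
  "eval2 (F + G) P = eval2 F P + eval2 G P" "eval2 (F * G) P = eval2 F P * eval2 G P"
  "eval2 (pCons a F) P = poly a (fst P) + snd P * eval2 F P" "eval2 0 P = 0"
  "eval2 (Polynomial.smult a F) P = poly a (fst P) * eval2 F P"
  by (auto simp: eval2_def split: prod.splits)

lemma continuous_eval2 [continuous_intros]: "continuous_on S (eval2 F)"
proof (induction F)
  case 0
  have "eval2 0 = (\<lambda>_. 0)" by auto
  then show ?case by simp
next
  case (pCons a F)
  have "eval2 (pCons a F) = (\<lambda>P. poly a (fst P) + snd P * eval2 F P)" by auto
  then show ?case using pCons by (auto intro!: continuous_intros)
qed

section \<open>Local branches and density\<close>

lemma eventually_poly_nonzero: "p \<noteq> 0 \<Longrightarrow> eventually (\<lambda>x. poly p x \<noteq> 0) (at (a::complex))"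
  using islimpt_finite[OF poly_roots_finite[of p], of a] by (simp add: islimpt_iff_eventually)

text \<open>A local section of the projection \<open>(x, y) \<mapsto> x\<close> through a given point of the curve.\<close>

definition branch :: "(nat \<Rightarrow> complex) \<Rightarrow> point \<Rightarrow> complex \<Rightarrow> complex" where
  "branch z = (\<lambda>(x, y) t. y * csqrt (poly (quintic z) t / poly (quintic z) x))"

lemma branch_self: "(x, y) \<in> curve z \<Longrightarrow> branch z (x, y) x = y"
  by (simp add: branch_def curve_quintic_nonzero)

lemma branch_mem_curve:
  "(x, y) \<in> curve z \<Longrightarrow> poly (quintic z) t \<noteq> 0 \<Longrightarrow> (t, branch z (x, y) t) \<in> curve z"
  using curve_quintic_nonzero[of x y z] by (auto simp: branch_def mem_curve_iff power_mult_distrib)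

text \<open>The radicand is normalised by its value at \<open>x\<close>, so \<open>csqrt\<close> is
  differentiated at 1, away from its branch cut.\<close>

lemma branch_has_field_derivative:
  assumes "(x, y) \<in> curve z"
  shows "(branch z (x, y) has_field_derivative poly (pderiv (quintic z)) x / (2 * y)) (at x)"
proof -
  have nz: "poly (quintic z) x \<noteq> 0" "y \<noteq> 0" "y\<^sup>2 = poly (quintic z) x"
    using assms curve_quintic_nonzero by (auto simp: mem_curve_iff)
  have "((\<lambda>t. y * csqrt (poly (quintic z) t / poly (quintic z) x)) has_field_derivative
      y * (inverse (2 * csqrt (poly (quintic z) x / poly (quintic z) x))
         * (poly (pderiv (quintic z)) x / poly (quintic z) x))) (at x)"
    using nz by (auto intro!: derivative_eq_intros simp: mult_ac)
  moreover have "y * (inverse (2 * csqrt (poly (quintic z) x / poly (quintic z) x))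
         * (poly (pderiv (quintic z)) x / poly (quintic z) x)) = poly (pderiv (quintic z)) x / (2 * y)"
    using nz(2) unfolding nz(3)[symmetric] by (simp add: power2_eq_square)
  ultimately show ?thesis by (simp add: branch_def)
qed

text \<open>As \<open>p\<close> has finitely many roots, the branch approaches the given point
  through points of the curve where \<open>p\<close> is nonzero; there \<open>f\<close> and
  \<open>g\<close> agree, hence so do their limits.\<close>

lemma eq_on_curve_by_density:
  fixes f g :: "point \<Rightarrow> complex"
  assumes "continuous_on (curve z) f" "continuous_on (curve z) g" "p \<noteq> 0"
    and "\<And>x y. (x, y) \<in> curve z \<Longrightarrow> poly p x \<noteq> 0 \<Longrightarrow> f (x, y) = g (x, y)"
    and "(x, y) \<in> curve z"
  shows "f (x, y) = g (x, y)"
proof -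
  let ?B = "\<lambda>t. (t, branch z (x, y) t)"
  have "isCont (branch z (x, y)) x"
    using branch_has_field_derivative[OF assms(5)] DERIV_isCont by blast
  then have "(?B \<longlongrightarrow> (x, y)) (at x)"
    using branch_self[OF assms(5)] by (auto intro!: tendsto_eq_intros simp: isCont_def)
  moreover have ev: "eventually (\<lambda>t. ?B t \<in> curve z) (at x)"
    using eventually_poly_nonzero[OF quintic_nonzero[of z], of x]
    by eventually_elim (rule branch_mem_curve[OF assms(5)])
  moreover have "eventually (\<lambda>t. ?B t \<noteq> (x, y)) (at x)"
    using eventually_neq_at_within[of x x UNIV] by eventually_elim simp
  ultimately have lim: "filterlim ?B (at (x, y) within curve z) (at x)"
    by (simp add: filterlim_at eventually_conj)
  have f: "((\<lambda>t. f (?B t)) \<longlongrightarrow> f (x, y)) (at x)"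
    and g: "((\<lambda>t. g (?B t)) \<longlongrightarrow> g (x, y)) (at x)"
    using assms(1,2,5) by (auto intro: filterlim_compose[OF _ lim] simp: continuous_on_def)
  have "eventually (\<lambda>t. f (?B t) = g (?B t)) (at x)"
    using ev eventually_poly_nonzero[OF assms(3), of x] by eventually_elim (use assms(4) in auto)
  then have "((\<lambda>t. g (?B t)) \<longlongrightarrow> f (x, y)) (at x)" by (rule Lim_transform_eventually[OF f])
  then show ?thesis using g tendsto_unique[OF at_neq_bot] by blast
qed

text \<open>\<open>A\<close> and \<open>B\<close> carry the parts even and odd under
  \<open>iota\<close>. Writing the odd part over \<open>y\<close> matches the given odd forms and
  makes the connection act on it by a mere shift of the weights.\<close>

definition ratfun :: "(nat \<Rightarrow> complex) \<Rightarrow> nat \<Rightarrow> complex poly \<Rightarrow> complex poly \<Rightarrow> point \<Rightarrow> complex" where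
  "ratfun z n A B = (\<lambda>(x, y). if (x, y) \<in> curve z
     then (poly A x + poly B x / y) / poly (quintic z) x ^ n else 0)"

lemma poly_eqI_quintic:
  assumes "\<And>x. poly (quintic z) x \<noteq> 0 \<Longrightarrow> poly A x = poly B x"
  shows "A = B"
proof -
  have "poly ((A - B) * quintic z) x = 0" for x using assms[of x] by auto
  then show ?thesis using poly_all_0_iff_0[of "(A - B) * quintic z"] by simp
qed

text \<open>Adding the equations at \<open>(x, y)\<close> and \<open>(x, - y)\<close> isolates the
  even parts; the odd parts follow.\<close>

lemma ratfun_eq_iff: "ratfun z n A B = ratfun z n C D \<longleftrightarrow> A = C \<and> B = D"
proof
  assume eq: "ratfun z n A B = ratfun z n C D"
  have "poly A x = poly C x \<and> poly B x = poly D x" if "poly (quintic z) x \<noteq> 0" for x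
  proof -
    define y where "y = csqrt (poly (quintic z) x)"
    have c: "(x, y) \<in> curve z" "(x, - y) \<in> curve z" "y \<noteq> 0"
      using csqrt_mem_curve[OF that] that by (auto simp: y_def curve_uminus)
    have "poly A x + poly B x / y = poly C x + poly D x / y"
      "poly A x - poly B x / y = poly C x - poly D x / y"
      using fun_cong[OF eq, of "(x, y)"] fun_cong[OF eq, of "(x, - y)"] c that
      by (simp_all add: ratfun_def)
    then have "(poly A x + poly B x / y) + (poly A x - poly B x / y)
        = (poly C x + poly D x / y) + (poly C x - poly D x / y)" by (simp only:)
    then have "2 * poly A x = 2 * poly C x" by simp
    moreover from this have "poly B x / y = poly D x / y"
      using \<open>poly A x + poly B x / y = poly C x + poly D x / y\<close> by simp
    ultimately show ?thesis using c by simp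
  qed
  then show "A = C \<and> B = D" by (auto intro!: poly_eqI_quintic[of z])
qed simp

lemma ratfun_raise:
  "ratfun z n A B = ratfun z (n + k) (A * quintic z ^ k) (B * quintic z ^ k)"
  using curve_quintic_nonzero by (auto simp: ratfun_def fun_eq_iff power_add field_simps)

lemma ratfun_regular: "ratfun z n A B \<in> regular_functions z"
  unfolding regular_functions_def
proof (intro CollectI conjI allI ballI impI)
  fix P assume "P \<notin> curve z"
  then show "ratfun z n A B P = 0" by (auto simp: ratfun_def split: prod.splits)
next
  fix P assume P: "P \<in> curve z"
  have nz: "snd Q \<noteq> 0" "poly (quintic z) (fst Q) \<noteq> 0" if "Q \<in> curve z" for Q
    using that curve_quintic_nonzero[of "fst Q" "snd Q"] mem_curve_iff[of "fst Q" "snd Q"] by auto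
  \<comment> \<open>Numerator and denominator are multiplied by \<open>y\<close>:
    \<open>B + A y\<close> over \<open>q ^ n y\<close>, with \<open>q\<close> the quintic.\<close>
  have "ratfun z n A B Q = eval2 [:B, A:] Q / eval2 [:0, quintic z ^ n:] Q" if "Q \<in> curve z" for Q
    using that nz[OF that] by (auto simp: ratfun_def case_prod_unfold add_divide_distrib)
  moreover have "eval2 [:0, quintic z ^ n:] P \<noteq> 0" using nz[OF P] by simp
  ultimately show "\<exists>F G. eval2 G P \<noteq> 0 \<and>
      (\<forall>Q\<in>curve z. eval2 G Q \<noteq> 0 \<longrightarrow> ratfun z n A B Q = eval2 F Q / eval2 G Q)" by blast
qed

text \<open>A further factor \<open>y\<close> exchanges the two parts:
  \<open>y (a + b y) = b q + a y\<close> on the curve.\<close>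

lemma eval2_on_curve:
  "\<exists>a b. \<forall>(x, y) \<in> curve z. eval2 F (x, y) = poly a x + poly b x * y"
proof (induction F)
  case 0
  show ?case by (rule exI[of _ 0], rule exI[of _ 0]) auto
next
  case (pCons c F)
  then obtain a b where ab: "\<forall>(x, y) \<in> curve z. eval2 F (x, y) = poly a x + poly b x * y" by blast
  have "eval2 (pCons c F) (x, y) = poly (c + b * quintic z) x + poly a x * y" if "(x, y) \<in> curve z" for x y
  proof -
    have "eval2 F (x, y) = poly a x + poly b x * y" "y\<^sup>2 = poly (quintic z) x"
      using ab that by (auto simp: mem_curve_iff)
    then show ?thesis by (simp flip: \<open>y\<^sup>2 = _\<close>) (simp add: algebra_simps power2_eq_square)
  qed
  then show ?case by blast
qed

text \<open>This is the norm of \<open>a + b y\<close>. As the quintic has odd degree, nonzero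
  \<open>a\<^sup>2\<close> and \<open>b\<^sup>2 * quintic z\<close> have degrees of different
  parity.\<close>

lemma norm_poly_nonzero:
  assumes "a \<noteq> 0 \<or> b \<noteq> 0"
  shows "a\<^sup>2 - b\<^sup>2 * quintic z \<noteq> 0"
proof
  assume "a\<^sup>2 - b\<^sup>2 * quintic z = 0"
  then have eq: "a\<^sup>2 = b\<^sup>2 * quintic z" by simp
  then have "b \<noteq> 0" "a \<noteq> 0" using assms by auto
  then have "2 * degree a = 2 * degree b + 5"
    using arg_cong[OF eq, of degree] by (simp add: degree_power_eq degree_mult_eq)
  then show False by presburger
qed

lemma regular_continuous:
  assumes "g \<in> regular_functions z"
  shows "continuous_on (curve z) g"
  unfolding continuous_on_def
proof
  fix P assume P: "P \<in> curve z"
  then obtain F G where FG: "eval2 G P \<noteq> 0"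
      "\<And>Q. Q \<in> curve z \<Longrightarrow> eval2 G Q \<noteq> 0 \<Longrightarrow> g Q = eval2 F Q / eval2 G Q"
    using assms by (auto simp: regular_functions_def)
  have lim: "(eval2 H \<longlongrightarrow> eval2 H P) (at P within curve z)" for H
    using continuous_eval2[of "curve z" H] P by (simp add: continuous_on_def)
  have "eventually (\<lambda>Q. eval2 G Q \<noteq> 0) (at P within curve z)"
    using lim FG(1) by (rule tendsto_imp_eventually_ne)
  then have "eventually (\<lambda>Q. eval2 F Q / eval2 G Q = g Q) (at P within curve z)"
    using FG(2) by (auto simp: eventually_at_filter elim: eventually_mono)
  moreover have "((\<lambda>Q. eval2 F Q / eval2 G Q) \<longlongrightarrow> g P) (at P within curve z)"
    using FG P by (auto intro!: tendsto_divide lim)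
  ultimately show "(g \<longlongrightarrow> g P) (at P within curve z)"
    by (rule Lim_transform_eventually[rotated])
qed

text \<open>The roots of the denominator \<open>p\<close> are cancelled one at a time: over a root that is not a
  branch point there are two points of the curve, which forces both numerators to vanish.\<close>

lemma clear_denominator:
  assumes "p \<noteq> 0" "continuous_on (curve z) g"
    and "\<And>x y. (x, y) \<in> curve z \<Longrightarrow> poly p x * g (x, y) = poly c x + poly d x * y"
  shows "\<exists>n A B. \<forall>(x, y) \<in> curve z. g (x, y) = (poly A x + poly B x * y) / poly (quintic z) x ^ n"
  using assms
proof (induction "degree p" arbitrary: p c d g)
  case 0
  then obtain k where k: "p = [:k:]" "k \<noteq> 0" by (metis degree_eq_zeroE pCons_0_0)
  have "g (x, y) = (poly (Polynomial.smult (1 / k) c) x + poly (Polynomial.smult (1 / k) d) x * y)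
      / poly (quintic z) x ^ 0" if "(x, y) \<in> curve z" for x y
    using 0(4)[OF that] k by (simp add: field_simps)
  then show ?case by blast
next
  case (Suc m)
  have "\<not> constant (poly p)" using Suc(2) by (simp add: constant_degree)
  then obtain r where "poly p r = 0" using fundamental_theorem_of_algebra by blast
  then obtain p' where p': "p = [:- r, 1:] * p'" by (auto simp: poly_eq_0_iff_dvd elim: dvdE)
  then have p'0: "p' \<noteq> 0" and deg: "m = degree p'"
    using Suc(2,3) by (auto simp: degree_mult_eq simp del: mult_pCons_left)
  show ?case
  proof (cases "poly (quintic z) r = 0")
    case False
    define y where "y = csqrt (poly (quintic z) r)"
    have "(r, y) \<in> curve z" "(r, - y) \<in> curve z" "y \<noteq> 0"
      using csqrt_mem_curve[OF False] False by (auto simp: y_def curve_uminus)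
    then have plus: "poly c r + poly d r * y = 0" and minus: "poly c r + poly d r * (- y) = 0"
      using Suc(5) \<open>poly p r = 0\<close> by fastforce+
    have "2 * poly c r = (poly c r + poly d r * y) + (poly c r + poly d r * (- y))" by simp
    then have "poly c r = 0" by (simp only: plus minus) simp
    then have "poly d r = 0" using plus \<open>y \<noteq> 0\<close> by simp
    obtain c' d' where cd: "c = [:- r, 1:] * c'" "d = [:- r, 1:] * d'"
      using \<open>poly c r = 0\<close> \<open>poly d r = 0\<close> by (auto simp: poly_eq_0_iff_dvd elim!: dvdE)
    have "poly p' x * g (x, y) = poly c' x + poly d' x * y" if "(x, y) \<in> curve z" for x y
    \<comment> \<open>The factor \<open>x - r\<close> cancels only where \<open>x\<close> differs
      from \<open>r\<close>; density recovers the points over \<open>r\<close>.\<close>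
    proof (rule eq_on_curve_by_density[where p = "[:- r, 1:]", OF _ _ _ _ that,
          of "\<lambda>(x, y). poly p' x * g (x, y)" "\<lambda>(x, y). poly c' x + poly d' x * y", simplified])
      show "continuous_on (curve z) (\<lambda>(x, y). poly p' x * g (x, y))"
        using Suc(4) by (auto simp: case_prod_unfold intro!: continuous_intros)
      show "continuous_on (curve z) (\<lambda>(x, y). poly c' x + poly d' x * y)"
        by (auto simp: case_prod_unfold intro!: continuous_intros)
      show "poly p' x * g (x, y) = poly c' x + poly d' x * y" if "(x, y) \<in> curve z" "x \<noteq> r" for x y
      proof -
        have "(x - r) * (poly p' x * g (x, y)) = (x - r) * (poly c' x + poly d' x * y)"
          using Suc(5)[OF that(1)] by (simp add: p' cd algebra_simps)
        then show ?thesis using that by simp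
      qed
    qed
    then show ?thesis using Suc(1)[OF deg p'0 Suc(4)] by blast
  next
    case True
    then obtain q' where q': "quintic z = [:- r, 1:] * q'" by (auto simp: poly_eq_0_iff_dvd elim: dvdE)
    \<comment> \<open>At a branch point the induction hypothesis is applied to
      \<open>(x - r) g\<close> with denominator \<open>p'\<close>. Dividing by \<open>x - r\<close>
      means multiplying by \<open>q'\<close> and dividing by the quintic, whence
      \<open>Suc n\<close>.\<close>
    have "continuous_on (curve z) (\<lambda>(x, y). (x - r) * g (x, y))"
      using Suc(4) by (auto simp: case_prod_unfold intro!: continuous_intros)
    moreover have "poly p' x * (case (x, y) of (x, y) \<Rightarrow> (x - r) * g (x, y)) = poly c x + poly d x * y"
      if "(x, y) \<in> curve z" for x y
      using Suc(5)[OF that] by (simp add: p' algebra_simps)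
    ultimately obtain n A B where AB: "\<forall>(x, y) \<in> curve z.
        (case (x, y) of (x, y) \<Rightarrow> (x - r) * g (x, y)) = (poly A x + poly B x * y) / poly (quintic z) x ^ n"
      using Suc(1)[OF deg p'0] by blast
    have "g (x, y) = (poly (A * q') x + poly (B * q') x * y) / poly (quintic z) x ^ Suc n"
      if "(x, y) \<in> curve z" for x y
    proof -
      have nz: "poly (quintic z) x \<noteq> 0" using that curve_quintic_nonzero by blast
      have "(x - r) * g (x, y) = (poly A x + poly B x * y) / poly (quintic z) x ^ n"
        using AB that by auto
      then have num: "(x - r) * g (x, y) * poly (quintic z) x ^ n = poly A x + poly B x * y"
        using nz by simp
      have q'x: "poly (quintic z) x = (x - r) * poly q' x" by (simp add: q' algebra_simps)
      have "g (x, y) * poly (quintic z) x ^ Suc n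
          = poly q' x * ((x - r) * g (x, y) * poly (quintic z) x ^ n)"
        unfolding power_Suc by (subst q'x) (simp only: mult_ac)
      also have "\<dots> = poly (A * q') x + poly (B * q') x * y"
        unfolding num by (simp add: algebra_simps)
      finally show ?thesis using nz by (simp only: nonzero_eq_divide_eq power_not_zero not_False_eq_True)
    qed
    then show ?thesis by blast
  qed
qed

text \<open>One local quotient \<open>F / G\<close> suffices: multiplying by the conjugate of
  \<open>G\<close> gives a nonzero denominator \<open>p\<close> in \<open>x\<close> alone, the
  identity extends to the whole curve by density, and \<open>clear_denominator\<close> leaves only a
  power of the quintic.\<close>

lemma regular_functions_eq: "regular_functions z = {ratfun z n A B | n A B. True}"
proof (intro Set.equalityI subsetI)
  fix g assume g: "g \<in> regular_functions z"
  obtain P where P: "P \<in> curve z"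
    using eventually_happens[OF eventually_poly_nonzero[OF quintic_nonzero[of z], of 0]]
      csqrt_mem_curve by auto
  then obtain F G where FG: "eval2 G P \<noteq> 0"
      "\<And>Q. Q \<in> curve z \<Longrightarrow> eval2 G Q \<noteq> 0 \<Longrightarrow> g Q = eval2 F Q / eval2 G Q"
    using g by (auto simp: regular_functions_def)
  obtain a b where ab: "\<forall>(x, y) \<in> curve z. eval2 G (x, y) = poly a x + poly b x * y"
    using eval2_on_curve by blast
  obtain c d where cd: "\<forall>(x, y) \<in> curve z. eval2 F (x, y) = poly c x + poly d x * y"
    using eval2_on_curve by blast
  have "a \<noteq> 0 \<or> b \<noteq> 0" using FG(1) P ab by force
  define p where "p = a\<^sup>2 - b\<^sup>2 * quintic z"
  have p: "p \<noteq> 0" using norm_poly_nonzero[OF \<open>a \<noteq> 0 \<or> b \<noteq> 0\<close>] by (simp add: p_def)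
  have "poly p x * g (x, y) = poly (c * a - d * b * quintic z) x + poly (d * a - c * b) x * y"
    if "(x, y) \<in> curve z" for x y
  proof (rule eq_on_curve_by_density[OF _ _ p _ that,
        of "\<lambda>(x, y). poly p x * g (x, y)"
           "\<lambda>(x, y). poly (c * a - d * b * quintic z) x + poly (d * a - c * b) x * y", simplified prod.case])
    show "continuous_on (curve z) (\<lambda>(x, y). poly p x * g (x, y))"
      using regular_continuous[OF g] by (auto simp: case_prod_unfold intro!: continuous_intros)
    show "continuous_on (curve z)
        (\<lambda>(x, y). poly (c * a - d * b * quintic z) x + poly (d * a - c * b) x * y)"
      unfolding case_prod_unfold by (intro continuous_intros)
    fix x y assume xy: "(x, y) \<in> curve z" and px: "poly p x \<noteq> 0"
    have y2: "poly (quintic z) x = y\<^sup>2" using xy by (simp add: mem_curve_iff)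
    have px': "poly p x = (poly a x + poly b x * y) * (poly a x - poly b x * y)"
      by (simp add: p_def y2 algebra_simps power2_eq_square)
    have G: "eval2 G (x, y) = poly a x + poly b x * y" "eval2 F (x, y) = poly c x + poly d x * y"
      using ab cd xy by auto
    with px px' have "g (x, y) = (poly c x + poly d x * y) / (poly a x + poly b x * y)"
        and nz: "poly a x + poly b x * y \<noteq> 0"
      using FG(2)[OF xy] by auto
    then have "poly p x * g (x, y) = (poly a x - poly b x * y) * (poly c x + poly d x * y)"
      by (simp add: px')
    then show "poly p x * g (x, y)
        = poly (c * a - d * b * quintic z) x + poly (d * a - c * b) x * y"
      by (simp add: y2 algebra_simps power2_eq_square)
  qed
  then obtain n A B where AB: "\<forall>(x, y) \<in> curve z. g (x, y) = (poly A x + poly B x * y) / poly (quintic z) x ^ n"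
    using clear_denominator[OF p regular_continuous[OF g]] by blast
  \<comment> \<open>\<open>ratfun\<close> has its odd part over \<open>y\<close>, and
    \<open>B y = B q / y\<close> on the curve.\<close>
  have "g Q = ratfun z n A (B * quintic z) Q" for Q
  proof (cases "Q \<in> curve z")
    case True
    obtain x y where Q: "Q = (x, y)" by (cases Q)
    then have "poly (quintic z) x = y\<^sup>2" "y \<noteq> 0" using True by (auto simp: mem_curve_iff)
    then have "poly (B * quintic z) x / y = poly B x * y" by (simp add: power2_eq_square)
    then show ?thesis using AB True by (auto simp: ratfun_def Q)
  next
    case False
    then show ?thesis using g by (auto simp: ratfun_def regular_functions_def split: prod.splits)
  qed
  then show "g \<in> {ratfun z n A B | n A B. True}" by blast
qed (use ratfun_regular in blast)

section \<open>Regular forms and the exterior derivative\<close>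

definition rform :: "(nat \<Rightarrow> complex) \<Rightarrow> nat \<Rightarrow> complex poly \<Rightarrow> complex poly \<Rightarrow> form" where
  "rform z n A B = dx_form z (ratfun z n A B)"

lemma dx_form_eq_rform:
  assumes "\<And>x y. (x, y) \<in> curve z \<Longrightarrow> h (x, y) = (poly A x + poly B x / y) / poly (quintic z) x ^ n"
  shows "dx_form z h = rform z n A B"
  using assms by (auto simp: rform_def dx_form_def ratfun_def fun_eq_iff)

lemma rform_apply:
  "rform z n A B (x, y) w = (if (x, y) \<in> curve z \<and> w \<in> tangent_space z (x, y)
     then (poly A x + poly B x / y) / poly (quintic z) x ^ n * fst w else 0)"
  by (simp add: rform_def dx_form_def ratfun_def)

lemma rform_eq_iff: "rform z n A B = rform z n C D \<longleftrightarrow> A = C \<and> B = D"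
proof
  assume eq: "rform z n A B = rform z n C D"
  have "ratfun z n A B (x, y) = ratfun z n C D (x, y)" for x y
  proof (cases "(x, y) \<in> curve z")
    case True
    then show ?thesis
      using fun_cong[OF fun_cong[OF eq, of "(x, y)"], of "(1, poly (pderiv (quintic z)) x / (2 * y))"]
      by (simp add: rform_def dx_form_def tangent_vector_iff)
  qed (simp add: ratfun_def)
  then show "A = C \<and> B = D" using ratfun_eq_iff by (metis ext surj_pair)
qed simp

lemma rform_raise: "rform z n A B = rform z (n + k) (A * quintic z ^ k) (B * quintic z ^ k)"
  unfolding rform_def by (subst ratfun_raise[of _ _ _ _ k]) (rule refl)

lemma rform_add: "(\<lambda>P w. rform z n A B P w + rform z n C D P w) = rform z n (A + C) (B + D)"
  by (auto simp: rform_apply fun_eq_iff add_divide_distrib algebra_simps)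

lemma rform_smult:
  "(\<lambda>P w. a * rform z n A B P w) = rform z n (Polynomial.smult a A) (Polynomial.smult a B)"
  by (auto simp: rform_apply fun_eq_iff algebra_simps)

lemma rform_0: "rform z n 0 0 = (\<lambda>P w. 0)"
  by (auto simp: rform_apply fun_eq_iff)

lemma rform_sum:
  "(\<lambda>P w. \<Sum>i\<in>I. a i * rform z n (A i) (B i) P w)
    = rform z n (\<Sum>i\<in>I. Polynomial.smult (a i) (A i)) (\<Sum>i\<in>I. Polynomial.smult (a i) (B i))"
proof (induction I rule: infinite_finite_induct)
  case (insert j I)
  have "(\<lambda>P w. \<Sum>i\<in>insert j I. a i * rform z n (A i) (B i) P w)
      = (\<lambda>P w. rform z n (Polynomial.smult (a j) (A j)) (Polynomial.smult (a j) (B j)) P w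
          + rform z n (\<Sum>i\<in>I. Polynomial.smult (a i) (A i)) (\<Sum>i\<in>I. Polynomial.smult (a i) (B i)) P w)"
    using insert by (simp flip: insert.IH rform_smult)
  then show ?case using insert.hyps by (simp add: rform_add)
qed (simp_all add: rform_0)

lemma iota_pullback_rform: "iota_pullback (rform z n A B) = rform z n A (- B)"
proof -
  have "iota w \<in> tangent_space z (iota P) \<longleftrightarrow> w \<in> tangent_space z P" "fst (iota w) = fst w" for P w
    by (auto simp: tangent_space_def iota_def split: prod.splits)
  then show ?thesis
    by (auto simp: iota_pullback_def rform_apply fun_eq_iff iota_def curve_uminus)
qed

text \<open>Evaluating a form on the tangent vector \<open>?v\<close> with first coordinate 1 yields
  a regular function \<open>h\<close>, and linearity on the tangent line gives the form back as
  \<open>h dx\<close>.\<close>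

lemma regular_forms_eq: "regular_forms z = {rform z n A B | n A B. True}"
proof (intro Set.equalityI subsetI)
  fix \<omega> assume \<omega>: "\<omega> \<in> regular_forms z"
  let ?v = "\<lambda>P. (1, poly (pderiv (quintic z)) (fst P) / (2 * snd P))"
  define h where "h = (\<lambda>P. if P \<in> curve z then \<omega> P (?v P) else 0)"
  have nz: "snd Q \<noteq> 0" if "Q \<in> curve z" for Q using that by (cases Q) (simp add: mem_curve_iff)
  have v: "w \<in> tangent_space z P \<longleftrightarrow> w = (fst w, snd (?v P) * fst w)" if "P \<in> curve z" for P w
    using tangent_vector_iff[of "fst P" "snd P" z w] that by simp
  have loc: "\<exists>A B G. eval2 G P \<noteq> 0 \<and> (\<forall>Q\<in>curve z. eval2 G Q \<noteq> 0 \<longrightarrow> (\<forall>w\<in>tangent_space z Q.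
      \<omega> Q w = (eval2 A Q * fst w + eval2 B Q * snd w) / eval2 G Q))" if "P \<in> curve z" for P
    using \<omega> that by (auto simp: regular_forms_def)
  have "h \<in> regular_functions z"
    unfolding regular_functions_def
  proof (intro CollectI conjI allI ballI impI)
    fix P assume P: "P \<in> curve z"
    obtain A B G where G: "eval2 G P \<noteq> 0" and \<omega>G: "\<And>Q w. Q \<in> curve z \<Longrightarrow> eval2 G Q \<noteq> 0 \<Longrightarrow>
        w \<in> tangent_space z Q \<Longrightarrow> \<omega> Q w = (eval2 A Q * fst w + eval2 B Q * snd w) / eval2 G Q"
      using loc[OF P] by blast
    \<comment> \<open>The slope of \<open>?v\<close> has the denominator \<open>2 y\<close>, which
      is \<open>[:0, 2:]\<close>.\<close>
    have "h Q = eval2 ([:0, 2:] * A + B * [:pderiv (quintic z):]) Q / eval2 ([:0, 2:] * G) Q"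
      if "Q \<in> curve z" "eval2 G Q \<noteq> 0" for Q
    proof -
      have "\<omega> Q (?v Q) = (eval2 A Q * fst (?v Q) + eval2 B Q * snd (?v Q)) / eval2 G Q"
        using \<omega>G[OF that] v[OF that(1)] by simp
      then show ?thesis using that nz[OF that(1)] by (simp add: h_def field_simps)
    qed
    moreover have "eval2 ([:0, 2:] * G) P \<noteq> 0" using G nz[OF P] by simp
    moreover have "eval2 ([:0, 2:] * G) Q \<noteq> 0 \<longrightarrow> eval2 G Q \<noteq> 0" for Q by simp
    ultimately show "\<exists>F G. eval2 G P \<noteq> 0 \<and> (\<forall>Q\<in>curve z. eval2 G Q \<noteq> 0 \<longrightarrow> h Q = eval2 F Q / eval2 G Q)"
      by blast
  qed (simp add: h_def)
  then obtain n A B where h: "h = ratfun z n A B" by (auto simp: regular_functions_eq)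
  have "\<omega> P w = dx_form z h P w" for P w
  proof (cases "P \<in> curve z \<and> w \<in> tangent_space z P")
    case True
    then have w: "w = (fst w, snd (?v P) * fst w)" using v by blast
    obtain A B G where G: "eval2 G P \<noteq> 0" and \<omega>G: "\<And>w.
        w \<in> tangent_space z P \<Longrightarrow> \<omega> P w = (eval2 A P * fst w + eval2 B P * snd w) / eval2 G P"
      using loc True by blast
    have "\<omega> P w = (eval2 A P * fst w + eval2 B P * (snd (?v P) * fst w)) / eval2 G P"
      using \<omega>G[of w] True w by (metis snd_conv)
    moreover have "\<omega> P (?v P) = (eval2 A P + eval2 B P * snd (?v P)) / eval2 G P"
      using \<omega>G[of "?v P"] v[of P] True by simp
    ultimately show ?thesis using True by (simp add: dx_form_def h_def algebra_simps add_divide_distrib)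
  next
    case False
    moreover have "\<forall>P w. P \<notin> curve z \<or> w \<notin> tangent_space z P \<longrightarrow> \<omega> P w = 0"
      using \<omega> by (simp add: regular_forms_def)
    ultimately have "\<omega> P w = 0" by blast
    then show ?thesis using False by (simp only: dx_form_def if_False)
  qed
  then have "\<omega> = rform z n A B" unfolding rform_def h by blast
  then show "\<omega> \<in> {rform z n A B | n A B. True}" by blast
next
  fix \<omega> assume "\<omega> \<in> {rform z n A B | n A B. True}"
  then obtain n A B where \<omega>: "\<omega> = dx_form z (ratfun z n A B)" by (auto simp: rform_def)
  show "\<omega> \<in> regular_forms z"
    unfolding regular_forms_def
  proof (intro CollectI conjI allI ballI impI)
    fix P assume "P \<in> curve z"
    then obtain F G where "eval2 G P \<noteq> 0"
        "\<And>Q. Q \<in> curve z \<Longrightarrow> eval2 G Q \<noteq> 0 \<Longrightarrow> ratfun z n A B Q = eval2 F Q / eval2 G Q"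
      using ratfun_regular[of z n A B] by (auto simp: regular_functions_def)
    then show "\<exists>A B G. eval2 G P \<noteq> 0 \<and> (\<forall>Q\<in>curve z. eval2 G Q \<noteq> 0 \<longrightarrow> (\<forall>w\<in>tangent_space z Q.
        \<omega> Q w = (eval2 A Q * fst w + eval2 B Q * snd w) / eval2 G Q))"
      by (intro exI[of _ F] exI[of _ 0] exI[of _ G]) (simp add: \<omega> dx_form_def)
  qed (auto simp: \<omega> dx_form_def)
qed

section \<open>Differentiation along the curve\<close>

lemma has_field_derivative_divide_power:
  fixes f g :: "'a::real_normed_field \<Rightarrow> 'a"
  assumes "(f has_field_derivative f') (at x)" "(g has_field_derivative g') (at x)" "g x \<noteq> 0"
  shows "((\<lambda>t. f t / g t ^ n) has_field_derivative (f' * g x - of_nat n * f x * g') / g x ^ Suc n) (at x)"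
proof -
  have "((\<lambda>t. f t / g t ^ n) has_field_derivative
      (f' * g x ^ n - f x * (of_nat n * (g' * g x ^ (n - Suc 0)))) / (g x ^ n * g x ^ n)) (at x)"
    using assms by (intro DERIV_divide DERIV_power) auto
  also have "(f' * g x ^ n - f x * (of_nat n * (g' * g x ^ (n - Suc 0)))) / (g x ^ n * g x ^ n)
      = (f' * g x - of_nat n * f x * g') / g x ^ Suc n"
    using assms(3) by (cases n) (simp_all add: field_simps)
  finally show ?thesis .
qed

lemma ratfun_differentiable:
  assumes "(x, y) \<in> curve z"
  shows "ratfun z n A B differentiable (at (x, y) within curve z)"
proof -
  have nz: "y \<noteq> 0" "poly (quintic z) x \<noteq> 0"
    using assms curve_quintic_nonzero by (auto simp: mem_curve_iff)
  have p: "((\<lambda>P. poly p (fst P)) has_derivative (\<lambda>h. poly (pderiv p) x * fst h)) (at (x, y) within curve z)"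
    for p :: "complex poly"
    using has_derivative_compose[of fst fst "(x, y)" "curve z" "poly p", OF has_derivative_fst[OF has_derivative_ident]]
      poly_DERIV[of p x] by (simp add: has_field_derivative_def)
  have "\<exists>D. ((\<lambda>P. (poly A (fst P) + poly B (fst P) / snd P) / poly (quintic z) (fst P) ^ n)
      has_derivative D) (at (x, y) within curve z)"
    using nz by (intro exI) (rule derivative_intros p | simp)+
  then obtain D where D: "((\<lambda>P. (poly A (fst P) + poly B (fst P) / snd P) / poly (quintic z) (fst P) ^ n)
      has_derivative D) (at (x, y) within curve z)" by blast
  have "(ratfun z n A B has_derivative D) (at (x, y) within curve z)"
    by (rule has_derivative_transform[OF assms _ D]) (auto simp: ratfun_def)
  then show ?thesis by (auto simp: differentiable_def)
qed

text \<open>The restriction of the function to a branch is differentiated by the chain rule and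
  directly. Uniqueness of derivatives in one variable then fixes the chosen derivative on the
  tangent line.\<close>

lemma ext_deriv_ratfun:
  "ext_deriv z (ratfun z n A B) = rform z (Suc n)
     (pderiv A * quintic z - of_nat n * A * pderiv (quintic z))
     (pderiv B * quintic z - Polynomial.smult (1 / 2) (B * pderiv (quintic z))
        - of_nat n * B * pderiv (quintic z))" (is "_ = rform z _ ?A ?B")
proof -
  have "frechet_derivative (ratfun z n A B) (at (x, y) within curve z) w
      = (poly ?A x + poly ?B x / y) / poly (quintic z) x ^ Suc n * fst w"
    if xy: "(x, y) \<in> curve z" and w: "w \<in> tangent_space z (x, y)" for x y w
  proof -
    let ?g = "ratfun z n A B" and ?b = "branch z (x, y)"
    let ?D = "frechet_derivative ?g (at (x, y) within curve z)"
    let ?U = "{t. poly (quintic z) t \<noteq> 0}"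
    define q q' y' where "q = poly (quintic z) x" and "q' = poly (pderiv (quintic z)) x" and "y' = q' / (2 * y)"
    have nz: "y \<noteq> 0" "q \<noteq> 0" "q = y\<^sup>2"
      using xy curve_quintic_nonzero by (auto simp: mem_curve_iff q_def)
    have b: "(?b has_field_derivative y') (at x)" "?b x = y"
      using branch_has_field_derivative[OF xy] branch_self[OF xy] by (simp_all add: y'_def q'_def)
    have U: "open ?U" "x \<in> ?U"
      using nz by (auto simp: q_def intro!: open_Collect_neq continuous_intros)
    have "(?g has_derivative ?D) (at (x, ?b x) within curve z)"
      using ratfun_differentiable[OF xy] b(2) by (simp add: frechet_derivative_works)
    then have "(?g has_derivative ?D) (at (x, ?b x) within (\<lambda>t. (t, ?b t)) ` ?U)"
      by (rule has_derivative_subset) (use branch_mem_curve[OF xy] in auto)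
    moreover have "((\<lambda>t. (t, ?b t)) has_derivative (\<lambda>h. (h, y' * h))) (at x within ?U)"
      using b(1)[unfolded has_field_derivative_def]
      by (intro has_derivative_Pair has_derivative_ident) (rule has_derivative_at_withinI)
    ultimately have "((\<lambda>t. ?g (t, ?b t)) has_derivative (\<lambda>h. ?D (h, y' * h))) (at x within ?U)"
      by (intro has_derivative_in_compose[where f = "\<lambda>t. (t, ?b t)" and g = ?g]) auto
    then have 1: "((\<lambda>t. ?g (t, ?b t)) has_derivative (\<lambda>h. ?D (h, y' * h))) (at x)"
      using at_within_open[OF U(2,1)] by simp
    have "((\<lambda>t. poly A t + poly B t / ?b t) has_field_derivative
        poly (pderiv A) x + (poly (pderiv B) x * y - poly B x * y') / (y * y)) (at x)"
      using b nz by (auto intro!: derivative_eq_intros poly_DERIV)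
    then have "((\<lambda>t. (poly A t + poly B t / ?b t) / poly (quintic z) t ^ n) has_field_derivative
        ((poly (pderiv A) x + (poly (pderiv B) x * y - poly B x * y') / (y * y)) * q
          - of_nat n * (poly A x + poly B x / y) * q') / q ^ Suc n) (at x)" (is "(_ has_field_derivative ?d) _")
      using has_field_derivative_divide_power[OF _ poly_DERIV[of "quintic z" x]] nz b(2)
      by (fastforce simp: q_def q'_def)
    also have "?d = (poly ?A x + poly ?B x / y) / q ^ Suc n"
    proof -
      have "(poly (pderiv A) x + (poly (pderiv B) x * y - poly B x * y') / (y * y)) * q
          - of_nat n * (poly A x + poly B x / y) * q' = poly ?A x + poly ?B x / y"
      proof -
        have "(a + (b * y - d * (q' / (2 * y))) / (y * y)) * (y * y) - m * (k + d / y) * q'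
            = a * (y * y) - m * k * q' + (b * (y * y) - 1 / 2 * (d * q') - m * d * q') / y" for a b d k m
        proof -
          have "(a + r / (y * y)) * (y * y) = a * (y * y) + r" for r
            using nz(1) by (simp add: distrib_right)
          then show ?thesis
            using nz(1) by (simp only:) (simp add: diff_divide_distrib add_divide_distrib algebra_simps)
        qed
        moreover have "poly ?A x = poly (pderiv A) x * (y * y) - of_nat n * poly A x * q'"
          "poly ?B x = poly (pderiv B) x * (y * y) - 1 / 2 * (poly B x * q') - of_nat n * poly B x * q'"
          using nz(3) by (simp_all add: q_def q'_def power2_eq_square)
        ultimately show ?thesis by (simp only: y'_def nz(3) power2_eq_square)
      qed
      then show ?thesis by simp
    qed
    finally have "((\<lambda>t. (poly A t + poly B t / ?b t) / poly (quintic z) t ^ n) has_derivative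
        (\<lambda>h. (poly ?A x + poly ?B x / y) / q ^ Suc n * h)) (at x)"
      by (simp only: has_field_derivative_def)
    then have 2: "((\<lambda>t. ?g (t, ?b t)) has_derivative
        (\<lambda>h. (poly ?A x + poly ?B x / y) / q ^ Suc n * h)) (at x)"
      \<comment> \<open>\<open>ratfun\<close> is zero off the curve, so its formula is used only on
        \<open>?U\<close>, where the branch stays on the curve.\<close>
      by (rule has_derivative_transform_within_open[OF _ U])
        (use branch_mem_curve[OF xy] in \<open>auto simp: ratfun_def\<close>)
    have "?D (fst w, y' * fst w) = (poly ?A x + poly ?B x / y) / q ^ Suc n * fst w"
      using has_derivative_unique[OF 1 2] by (rule fun_cong)
    then show ?thesis
      using w tangent_vector_iff[OF xy, of w] by (simp only: q_def q'_def y'_def)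
  qed
  then show ?thesis by (auto simp: ext_deriv_def rform_apply fun_eq_iff)
qed

section \<open>The image of the connection\<close>

lemma sum_residues:
  assumes "finite I" "poly (root_poly e I) x \<noteq> 0"
  shows "(\<Sum>i\<in>I. l i / (x - e i)) = poly (weight_poly l e I) x / poly (root_poly e I) x"
proof -
  have "l i / (x - e i) = l i * poly (root_poly e (I - {i})) x / poly (root_poly e I) x" if "i \<in> I" for i
  proof -
    have "poly (root_poly e I) x = (x - e i) * poly (root_poly e (I - {i})) x"
      using prod.remove[OF assms(1) that, of "\<lambda>i. x - e i"] by (simp add: poly_root_poly)
    then show ?thesis using assms(2) by auto
  qed
  then show ?thesis by (simp add: weight_poly_def poly_sum sum_divide_distrib)
qed

text \<open>The shift of the weights on the odd part comes from \<open>d(1/y) = - q' / (2 q y) dx\<close>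
  with \<open>q = y\<^sup>2\<close>.\<close>

lemma nabla_ratfun:
  "nabla z c (ratfun z n A B) = rform z (Suc n) (twisted_num (\<lambda>j. 2 * c j) z {..4} n A)
     (twisted_num (\<lambda>j. 2 * c j - 1 / 2) z {..4} n B)"
proof -
  let ?W = "weight_poly (\<lambda>j. 2 * c j) z {..4}"
  \<comment> \<open>Lowering every weight by one half subtracts half of the unit-weight polynomial,
    which is \<open>pderiv (quintic z)\<close>.\<close>
  have half: "weight_poly (\<lambda>j. 2 * c j - 1 / 2) z {..4} = ?W - Polynomial.smult (1 / 2) (pderiv (quintic z))"
    by (rule poly_eqI) (simp add: quintic_root_poly pderiv_root_poly weight_poly_def coeff_sum
        sum_subtractf sum_distrib_left left_diff_distrib)
  have "(\<lambda>P w. ratfun z n A B P * dlog_T z c P w) = rform z (Suc n) (A * ?W) (B * ?W)"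
  proof -
    have "(\<lambda>P w. ratfun z n A B P * dlog_T z c P w)
        = dx_form z (\<lambda>P. ratfun z n A B P * (case P of (x, y) \<Rightarrow> \<Sum>j\<le>4. 2 * c j / (x - z j)))"
      by (auto simp: dlog_T_def dx_form_def fun_eq_iff)
    also have "\<dots> = rform z (Suc n) (A * ?W) (B * ?W)"
    proof (rule dx_form_eq_rform)
      fix x y assume xy: "(x, y) \<in> curve z"
      then have q: "poly (quintic z) x \<noteq> 0" by (rule curve_quintic_nonzero)
      have L: "(\<Sum>j\<le>4. 2 * c j / (x - z j)) = poly ?W x / poly (quintic z) x"
        using sum_residues[of "{..4}" z x "\<lambda>j. 2 * c j"] q by (simp add: quintic_root_poly)
      show "ratfun z n A B (x, y) * (case (x, y) of (x, y) \<Rightarrow> \<Sum>j\<le>4. 2 * c j / (x - z j))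
          = (poly (A * ?W) x + poly (B * ?W) x / y) / poly (quintic z) x ^ Suc n"
        unfolding prod.case L using xy by (simp add: ratfun_def distrib_right mult.commute)
    qed
    finally show ?thesis .
  qed
  then have "nabla z c (ratfun z n A B) = (\<lambda>P w. ext_deriv z (ratfun z n A B) P w
      + rform z (Suc n) (A * ?W) (B * ?W) P w)"
    unfolding nabla_def by (metis (no_types))
  also have "\<dots> = rform z (Suc n) (twisted_num (\<lambda>j. 2 * c j) z {..4} n A)
     (twisted_num (\<lambda>j. 2 * c j - 1 / 2) z {..4} n B)"
    unfolding ext_deriv_ratfun rform_add twisted_num_def half quintic_root_poly[symmetric] rform_eq_iff
    by (simp add: algebra_simps)
  finally show ?thesis .
qed

section \<open>The module of regular forms\<close>

lemma carrier_forms_module: "carrier (forms_module z) = {rform z n A B | n A B. True}"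
  by (simp add: forms_module_def regular_forms_eq)

lemma rform_mem_carrier [simp]: "rform z n A B \<in> carrier (forms_module z)"
  by (auto simp: carrier_forms_module)

lemma forms_module_simps [simp]:
  "\<zero>\<^bsub>forms_module z\<^esub> = (\<lambda>P w. 0)"
  "\<omega> \<oplus>\<^bsub>forms_module z\<^esub> \<eta> = (\<lambda>P w. \<omega> P w + \<eta> P w)"
  "a \<odot>\<^bsub>forms_module z\<^esub> \<omega> = (\<lambda>P w. a * \<omega> P w)"
  by (simp_all add: forms_module_def)

lemma common_denominator:
  assumes "\<omega> \<in> carrier (forms_module z)" "\<eta> \<in> carrier (forms_module z)"
  obtains n A B C D where "\<omega> = rform z n A B" "\<eta> = rform z n C D"
proof -
  obtain n A B m C D where "\<omega> = rform z n A B" "\<eta> = rform z m C D"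
    using assms by (auto simp: carrier_forms_module)
  then have "\<omega> = rform z (n + m) (A * quintic z ^ m) (B * quintic z ^ m)"
    "\<eta> = rform z (n + m) (C * quintic z ^ n) (D * quintic z ^ n)"
    using rform_raise[of z n A B m] rform_raise[of z m C D n] by (simp_all add: add.commute)
  then show thesis using that by blast
qed

lemma module_forms: "module (ring_of_type_algebra :: complex ring) (forms_module z)"
proof (rule moduleI)
  let ?M = "forms_module z"
  show "cring (ring_of_type_algebra :: complex ring)" by (rule cring_from_type_algebra)
  show "abelian_group ?M"
  proof (rule abelian_groupI)
    fix \<omega> \<eta> assume "\<omega> \<in> carrier ?M" "\<eta> \<in> carrier ?M"
    then show "\<omega> \<oplus>\<^bsub>?M\<^esub> \<eta> \<in> carrier ?M"
      by (rule common_denominator) (simp add: rform_add)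
  next
    show "\<zero>\<^bsub>?M\<^esub> \<in> carrier ?M" using rform_mem_carrier[of z 0 0 0] by (simp only: rform_0 forms_module_simps)
  next
    fix \<omega> assume "\<omega> \<in> carrier ?M"
    then obtain n A B where "\<omega> = rform z n A B" by (auto simp: carrier_forms_module)
    then show "\<exists>\<eta>\<in>carrier ?M. \<eta> \<oplus>\<^bsub>?M\<^esub> \<omega> = \<zero>\<^bsub>?M\<^esub>"
      by (intro bexI[of _ "rform z n (- A) (- B)"]) (simp_all add: rform_add rform_0)
  qed (simp_all add: fun_eq_iff algebra_simps)
next
  fix a \<omega> assume "\<omega> \<in> carrier (forms_module z)"
  then obtain n A B where "\<omega> = rform z n A B" by (auto simp: carrier_forms_module)
  then show "a \<odot>\<^bsub>forms_module z\<^esub> \<omega> \<in> carrier (forms_module z)"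
    by (simp add: rform_smult)
qed (simp_all add: ring_of_type_algebra_def fun_eq_iff algebra_simps)

section \<open>The image of the connection as a submodule stable under the involution\<close>

definition nabla_image :: "(nat \<Rightarrow> complex) \<Rightarrow> (nat \<Rightarrow> complex) \<Rightarrow> form set" where
  "nabla_image z c = nabla z c ` regular_functions z"

lemma twisted_num_smult:
  "twisted_num l e I n (Polynomial.smult a A) = Polynomial.smult a (twisted_num l e I n A)"
  by (simp add: twisted_num_def pderiv_smult smult_add_right)

lemma twisted_num_uminus: "twisted_num l e I n (- A) = - twisted_num l e I n A"
  by (simp add: twisted_num_def pderiv_minus)

lemma nabla_ratfun_mem: "nabla z c (ratfun z n A B) \<in> nabla_image z c"
  using ratfun_regular by (auto simp: nabla_image_def)

lemma nabla_image_cases: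
  assumes "\<omega> \<in> nabla_image z c"
  obtains n A B where "\<omega> = nabla z c (ratfun z n A B)"
  using assms by (auto simp: nabla_image_def regular_functions_eq)

lemma nabla_image_smult:
  assumes "\<omega> \<in> nabla_image z c"
  shows "(\<lambda>P w. a * \<omega> P w) \<in> nabla_image z c"
proof -
  obtain n A B where "\<omega> = nabla z c (ratfun z n A B)" 
    using assms nabla_image_cases by blast
  then have "(\<lambda>P w. a * \<omega> P w)
      = nabla z c (ratfun z n (Polynomial.smult a A) (Polynomial.smult a B))"
    by (simp add: nabla_ratfun rform_smult twisted_num_smult)
  then show ?thesis by (simp only: nabla_ratfun_mem)
qed

lemma nabla_image_add:
  assumes "\<omega> \<in> nabla_image z c" "\<eta> \<in> nabla_image z c"
  shows "(\<lambda>P w. \<omega> P w + \<eta> P w) \<in> nabla_image z c"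
proof -
  obtain n A B m C D where "\<omega> = nabla z c (ratfun z n A B)" "\<eta> = nabla z c (ratfun z m C D)"
    using assms by (metis nabla_image_cases)
  then have "\<omega> = nabla z c (ratfun z (n + m) (A * quintic z ^ m) (B * quintic z ^ m))"
    "\<eta> = nabla z c (ratfun z (n + m) (C * quintic z ^ n) (D * quintic z ^ n))"
    using ratfun_raise[of z n A B m] ratfun_raise[of z m C D n] by (simp_all add: add.commute)
  then have "(\<lambda>P w. \<omega> P w + \<eta> P w) = nabla z c (ratfun z (n + m)
      (A * quintic z ^ m + C * quintic z ^ n) (B * quintic z ^ m + D * quintic z ^ n))"
    by (simp add: nabla_ratfun rform_add twisted_num_add)
  then show ?thesis by (simp only: nabla_ratfun_mem)
qed

lemma nabla_image_uminus:
  "\<omega> \<in> nabla_image z c \<Longrightarrow> (\<lambda>P w. - \<omega> P w) \<in> nabla_image z c"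
  using nabla_image_smult[of \<omega> z c "- 1"] by simp

lemma forms_module_a_inv:
  assumes "\<omega> \<in> carrier (forms_module z)"
  shows "\<ominus>\<^bsub>forms_module z\<^esub> \<omega> = (\<lambda>P w. - \<omega> P w)"
proof -
  interpret module "ring_of_type_algebra :: complex ring" "forms_module z" by (rule module_forms)
  have "(\<lambda>P w. - 1 * \<omega> P w) \<in> carrier (forms_module z)"
    using smult_closed[of "- 1" \<omega>] assms by (simp add: ring_of_type_algebra_def)
  then show ?thesis using assms by (intro M.minus_equality) auto
qed

lemma quotient_module_forms:
  "quotient_module (ring_of_type_algebra :: complex ring) (forms_module z) (nabla_image z c)"
proof -
  interpret module "ring_of_type_algebra :: complex ring" "forms_module z" by (rule module_forms)
  have sub: "nabla_image z c \<subseteq> carrier (forms_module z)"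
    by (auto simp: nabla_ratfun elim!: nabla_image_cases)
  have "submodule (nabla_image z c) (ring_of_type_algebra :: complex ring) (forms_module z)"
  proof (rule submoduleI)
    show "\<zero>\<^bsub>forms_module z\<^esub> \<in> nabla_image z c"
      using nabla_ratfun_mem[of z c 0 0 0] by (simp add: nabla_ratfun twisted_num_def rform_0)
    show "\<ominus>\<^bsub>forms_module z\<^esub> \<omega> \<in> nabla_image z c" if "\<omega> \<in> nabla_image z c" for \<omega>
      using that sub by (subst forms_module_a_inv) (auto intro: nabla_image_uminus)
  qed (use sub in \<open>auto intro: nabla_image_add nabla_image_smult\<close>)
  then show ?thesis
    by (intro quotient_module.intro quotient_module_axioms.intro module_axioms)
qed

lemma forms_module_minus:
  assumes "\<eta> \<in> carrier (forms_module z)"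
  shows "\<omega> \<ominus>\<^bsub>forms_module z\<^esub> \<eta> = (\<lambda>P w. \<omega> P w - \<eta> P w)"
  using forms_module_a_inv[OF assms] by (simp add: a_minus_def)

lemma forms_module_finsum:
  assumes "finite I" "v \<in> I \<rightarrow> carrier (forms_module z)"
  shows "(\<Oplus>\<^bsub>forms_module z\<^esub>i\<in>I. v i) = (\<lambda>P w. \<Sum>i\<in>I. v i P w)"
proof -
  interpret module "ring_of_type_algebra :: complex ring" "forms_module z" by (rule module_forms)
  show ?thesis using assms
  proof (induction I rule: finite_induct)
    case empty
    then show ?case by (simp only: M.finsum_empty forms_module_simps sum.empty)
  next
    case (insert j I)
    then have "(\<Oplus>\<^bsub>forms_module z\<^esub>i\<in>insert j I. v i) = v j \<oplus>\<^bsub>forms_module z\<^esub> (\<Oplus>\<^bsub>forms_module z\<^esub>i\<in>I. v i)"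
      by (intro M.finsum_insert) auto
    then show ?case using insert by simp
  qed
qed

text \<open>Pulling back amounts to negating \<open>B\<close>, before or after applying
  \<open>nabla\<close>. Equality follows because \<open>iota_pullback\<close> is an
  involution.\<close>

lemma iota_pullback_nabla_image: "iota_pullback ` nabla_image z c = nabla_image z c"
proof -
  have "iota_pullback \<omega> \<in> nabla_image z c" if \<omega>: "\<omega> \<in> nabla_image z c" for \<omega>
  proof -
    obtain n A B where "\<omega> = nabla z c (ratfun z n A B)" 
      using \<omega> nabla_image_cases by blast
    then have "iota_pullback \<omega> = nabla z c (ratfun z n A (- B))"
      by (simp add: nabla_ratfun iota_pullback_rform twisted_num_uminus)
    then show ?thesis by (simp only: nabla_ratfun_mem)
  qed
  moreover have "iota_pullback (iota_pullback \<omega>) = \<omega>" for \<omega>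
    by (simp add: iota_pullback_def iota_def case_prod_unfold)
  ultimately show ?thesis by (metis (no_types, lifting) image_eqI image_subset_iff subsetI subset_antisym)
qed

section \<open>The basis forms\<close>

text \<open>A Lagrange-type basis for the nodes 0, \<open>a\<close>, \<open>b\<close>: the first
  entry is monic of degree three and vanishes at all nodes, each other entry vanishes at two of
  them.\<close>

definition cubic :: "complex \<Rightarrow> complex \<Rightarrow> nat \<Rightarrow> complex poly" where
  "cubic a b i =
     [[:0, 1:] * [:- a, 1:] * [:- b, 1:],
      [:- a, 1:] * [:- b, 1:],
      Polynomial.smult (1 - a) ([:0, 1:] * [:- b, 1:]),
      Polynomial.smult (1 - b) ([:0, 1:] * [:- a, 1:])] ! i"

lemma sum_cubic:
  "(\<Sum>i<4. Polynomial.smult (k i) (cubic a b i)) =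
     Polynomial.smult (k 0) (cubic a b 0) + Polynomial.smult (k 1) (cubic a b 1)
       + Polynomial.smult (k 2) (cubic a b 2) + Polynomial.smult (k 3) (cubic a b 3)"
  by (simp add: eval_nat_numeral)

lemma poly_sum_cubic:
  "poly (\<Sum>i<4. Polynomial.smult (k i) (cubic a b i)) 0 = k 1 * (a * b)"
  "poly (\<Sum>i<4. Polynomial.smult (k i) (cubic a b i)) a = k 2 * ((1 - a) * a * (a - b))"
  "poly (\<Sum>i<4. Polynomial.smult (k i) (cubic a b i)) b = k 3 * ((1 - b) * b * (b - a))"
  unfolding sum_cubic by (simp_all add: cubic_def algebra_simps)

lemma coeff_sum_cubic: "coeff (\<Sum>i<4. Polynomial.smult (k i) (cubic a b i)) 3 = k 0"
  unfolding sum_cubic by (simp add: cubic_def eval_nat_numeral)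

lemma degree_sum_cubic: "degree (\<Sum>i<4. Polynomial.smult (k i) (cubic a b i)) \<le> 3"
  unfolding sum_cubic
  by (intro degree_add_le order.trans[OF degree_smult_le]) (simp_all add: cubic_def)

context
  fixes a b :: complex
  assumes ab: "a \<noteq> 0" "b \<noteq> 0" "a \<noteq> 1" "b \<noteq> 1" "a \<noteq> b"
begin

lemma cubic_independent:
  assumes "(\<Sum>i<4. Polynomial.smult (k i) (cubic a b i)) = 0" "i < 4"
  shows "k i = 0"
proof -
  have "k 0 = 0" "k 1 = 0" "k 2 = 0" "k 3 = 0"
    using poly_sum_cubic[of k a b] coeff_sum_cubic[of k a b] ab unfolding assms(1) by simp_all
  moreover have "i \<in> {0, 1, 2, 3}" using assms(2) by auto
  ultimately show ?thesis by blast
qed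

text \<open>The values at the nodes and the coefficient of \<open>x ^ 3\<close> dictate
  \<open>k\<close>; the difference \<open>F\<close> then has degree below three and three distinct
  roots.\<close>

lemma cubic_spanning:
  assumes "degree S \<le> 3"
  obtains k where "S = (\<Sum>i<4. Polynomial.smult (k i) (cubic a b i))"
proof -
  define k where "k = (!) [coeff S 3, poly S 0 / (a * b), poly S a / ((1 - a) * a * (a - b)),
    poly S b / ((1 - b) * b * (b - a))]"
  have k: "k 0 = coeff S 3" "k 1 = poly S 0 / (a * b)" "k 2 = poly S a / ((1 - a) * a * (a - b))"
    "k 3 = poly S b / ((1 - b) * b * (b - a))"
    by (simp_all add: k_def)
  define F where "F = S - (\<Sum>i<4. Polynomial.smult (k i) (cubic a b i))"
  have "poly F 0 = 0" "poly F a = 0" "poly F b = 0"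
    using ab unfolding F_def poly_diff poly_sum_cubic k by simp_all
  then have dvd: "root_poly (\<lambda>x. x) {0, a, b} dvd F"
    by (intro root_poly_dvd) auto
  have "coeff F 3 = 0" unfolding F_def coeff_diff coeff_sum_cubic k by simp
  moreover have "degree F \<le> 3" unfolding F_def by (intro degree_diff_le assms degree_sum_cubic)
  ultimately have "degree F < 3"
    by (metis degree_0 leading_coeff_0_iff le_neq_implies_less zero_less_numeral)
  then have "F = 0"
    using root_poly_dvd_imp_zero[OF _ dvd] ab by simp
  then show thesis using that by (simp add: F_def)
qed

end

lemma two_times_nat_in_Ints: "x \<in> \<nat> \<Longrightarrow> 2 * x \<in> (\<int> :: complex set)"
  by (auto elim!: Nats_cases)

text \<open>The numerators of the given forms over \<open>q\<close>: they are divisible by \<open>x - z 3\<close> in the even case and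
  by \<open>x (x - z 3) (x - 1)\<close> in the odd case, and both quotients run through the same four cubics.\<close>

definition even_num :: "(nat \<Rightarrow> complex) \<Rightarrow> nat \<Rightarrow> complex poly" where
  "even_num z i = (if i \<le> 4 then cubic (z 1) (z 2) (i - 1) * root_poly z {3} else 0)"

definition odd_num :: "(nat \<Rightarrow> complex) \<Rightarrow> nat \<Rightarrow> complex poly" where
  "odd_num z i = (if i \<le> 4 then 0 else cubic (z 1) (z 2) (i - 5) * root_poly z {0, 3, 4})"

text \<open>The forms enter through their numerators over the quintic; that the given expressions
  have this shape is checked in the final theorem.\<close>

locale basis_forms =
  fixes z c :: "nat \<Rightarrow> complex" and \<phi> :: "nat \<Rightarrow> form"
  assumes inj_z: "inj_on z {..4}" and z0: "z 0 = 0" and z4: "z 4 = 1"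
    and c_sum: "(\<Sum>j\<le>5. c j) = 0"
    and c_generic: "\<And>j. j \<le> 5 \<Longrightarrow> 4 * c j \<notin> \<int>"
    and phi: "\<And>i. i \<in> {1..8} \<Longrightarrow> \<phi> i = rform z 1 (even_num z i) (odd_num z i)"
begin

lemma z_distinct: "i \<le> 4 \<Longrightarrow> j \<le> 4 \<Longrightarrow> z i = z j \<longleftrightarrow> i = j"
  using inj_z by (auto simp: inj_on_def)

lemma sum_c: "(\<Sum>j\<le>4. c j) = - c 5"
proof -
  have "(\<Sum>j\<le>5. c j) = (\<Sum>j\<le>4. c j) + c 5" by (simp add: eval_nat_numeral)
  then show ?thesis using c_sum by (simp add: add_eq_0_iff2)
qed

text \<open>The negated sum of the weights is \<open>2 * c 5\<close>. Doubling a natural weight, or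
  this number if natural, would make some \<open>4 * c j\<close> an integer.\<close>

sublocale even: generic_weights "{..4}" z "\<lambda>j. 2 * c j" "{3}"
proof
  show "2 * c i \<notin> \<nat>" if "i \<in> {..4}" for i
  proof
    assume "2 * c i \<in> \<nat>"
    then have "2 * (2 * c i) \<in> \<int>" by (rule two_times_nat_in_Ints)
    then show False using c_generic[of i] that by simp
  qed
  show "- (\<Sum>j\<le>4. 2 * c j) \<notin> \<nat>"
  proof
    assume "- (\<Sum>j\<le>4. 2 * c j) \<in> \<nat>"
    then have "2 * c 5 \<in> \<nat>" by (simp add: sum_c flip: sum_distrib_left)
    then have "2 * (2 * c 5) \<in> \<int>" by (rule two_times_nat_in_Ints)
    then show False using c_generic[of 5] by simp
  qed
qed (use inj_z in auto)

text \<open>Doubling \<open>2 * c j - 1 / 2\<close> and adding 1 gives \<open>4 * c j\<close>. The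
  five shifts turn the negated sum into \<open>2 * c 5 + 5 / 2\<close>, so doubling and subtracting
  5 gives \<open>4 * c 5\<close>.\<close>

sublocale odd: generic_weights "{..4}" z "\<lambda>j. 2 * c j - 1 / 2" "{0, 3, 4}"
proof
  show "2 * c i - 1 / 2 \<notin> \<nat>" if "i \<in> {..4}" for i
  proof
    assume "2 * c i - 1 / 2 \<in> \<nat>"
    then have "2 * (2 * c i - 1 / 2) + 1 \<in> \<int>"
      by (intro Ints_add Ints_1 two_times_nat_in_Ints)
    then show False using c_generic[of i] that by (simp add: algebra_simps)
  qed
  show "- (\<Sum>j\<le>4. 2 * c j - 1 / 2) \<notin> \<nat>"
  proof
    assume "- (\<Sum>j\<le>4. 2 * c j - 1 / 2) \<in> \<nat>"
    moreover have "- (\<Sum>j\<le>4. 2 * c j - 1 / 2) = 2 * c 5 + 5 / 2"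
      by (simp add: sum_c sum_subtractf flip: sum_distrib_left)
    ultimately have "2 * c 5 + 5 / 2 \<in> \<nat>" by (simp only:)
    then have "2 * (2 * c 5 + 5 / 2) - 5 \<in> \<int>"
      by (intro Ints_diff Ints_numeral two_times_nat_in_Ints)
    then show False using c_generic[of 5] by (simp add: algebra_simps)
  qed
qed (use inj_z in auto)

definition combination :: "(nat \<Rightarrow> complex) \<Rightarrow> form" where
  "combination a = (\<lambda>P w. \<Sum>i\<in>{1..8}. a i * \<phi> i P w)"

text \<open>Forms 1 to 4 are even and forms 5 to 8 odd, so the sum splits into two sums over the
  same cubics with indices shifted by 1 and 5.\<close>

lemma combination_eq:
  "combination a = rform z 1
     ((\<Sum>i<4. Polynomial.smult (a (i + 1)) (cubic (z 1) (z 2) i)) * root_poly z {3})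
     ((\<Sum>i<4. Polynomial.smult (a (i + 5)) (cubic (z 1) (z 2) i)) * root_poly z {0, 3, 4})"
proof -
  have I: "{1..8::nat} = {1, 2, 3, 4, 5, 6, 7, 8}" by auto
  have "(\<Sum>i\<in>{1..8}. Polynomial.smult (a i) (even_num z i))
      = (\<Sum>i<4. Polynomial.smult (a (i + 1)) (cubic (z 1) (z 2) i)) * root_poly z {3}"
    unfolding I sum_cubic by (simp add: even_num_def distrib_right eval_nat_numeral)
  moreover have "(\<Sum>i\<in>{1..8}. Polynomial.smult (a i) (odd_num z i))
      = (\<Sum>i<4. Polynomial.smult (a (i + 5)) (cubic (z 1) (z 2) i)) * root_poly z {0, 3, 4}"
    unfolding I sum_cubic by (simp add: odd_num_def distrib_right eval_nat_numeral)
  ultimately show ?thesis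
    using rform_sum[where I = "{1..8}" and a = a and z = z and n = 1 and A = "even_num z" and B = "odd_num z"] by (simp add: combination_def phi)
qed

lemma z12: "z 1 \<noteq> 0" "z 2 \<noteq> 0" "z 1 \<noteq> 1" "z 2 \<noteq> 1" "z 1 \<noteq> z 2"
  using z_distinct[of 1 0] z_distinct[of 2 0] z_distinct[of 1 4] z_distinct[of 2 4] z_distinct[of 1 2]
  by (simp_all add: z0 z4)

text \<open>Over one power of the quintic the even and odd numerators are compared separately;
  \<open>remainder_unique\<close> kills both remainders, and the cubics are independent.\<close>

lemma combination_independent:
  assumes "combination a \<in> nabla_image z c" "i \<in> {1..8}"
  shows "a i = 0"
proof -
  define S where "S = (\<Sum>i<4. Polynomial.smult (a (i + 1)) (cubic (z 1) (z 2) i))"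
  define S' where "S' = (\<Sum>i<4. Polynomial.smult (a (i + 5)) (cubic (z 1) (z 2) i))"
  obtain n A B where "combination a = nabla z c (ratfun z n A B)"
    using assms(1) nabla_image_cases by blast
  then have "rform z (1 + n) (S * root_poly z {3} * quintic z ^ n) (S' * root_poly z {0, 3, 4} * quintic z ^ n)
      = rform z (1 + n) (twisted_num (\<lambda>j. 2 * c j) z {..4} n A) (twisted_num (\<lambda>j. 2 * c j - 1 / 2) z {..4} n B)"
    unfolding combination_eq nabla_ratfun S_def[symmetric] S'_def[symmetric]
    by (subst (asm) rform_raise[of _ _ _ _ n]) simp
  then have eq: "twisted_num (\<lambda>j. 2 * c j) z {..4} n A = S * root_poly z {3} * root_poly z {..4} ^ n"
    "twisted_num (\<lambda>j. 2 * c j - 1 / 2) z {..4} n B = S' * root_poly z {0, 3, 4} * root_poly z {..4} ^ n"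
    by (simp_all only: rform_eq_iff quintic_root_poly)
  have deg: "degree S + 2 \<le> card {..4::nat}" "degree S' + 2 \<le> card {..4::nat}"
    using degree_sum_cubic[of "\<lambda>i. a (i + 1)" "z 1" "z 2"] degree_sum_cubic[of "\<lambda>i. a (i + 5)" "z 1" "z 2"]
    by (simp_all add: S_def S'_def)
  have 1: "a (i + 1) = 0" if "i < 4" for i
    using cubic_independent[OF z12, of "\<lambda>i. a (i + 1)"] even.remainder_unique[OF eq(1) deg(1)] that
    unfolding S_def by blast
  have 2: "a (i + 5) = 0" if "i < 4" for i
    using cubic_independent[OF z12, of "\<lambda>i. a (i + 5)"] odd.remainder_unique[OF eq(2) deg(2)] that
    unfolding S'_def by blast
  show ?thesis
  proof (cases "i \<le> 4")
    case True
    then show ?thesis using 1[of "i - 1"] assms(2) by auto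
  next
    case False
    then show ?thesis using 2[of "i - 5"] assms(2) by auto
  qed
qed

lemma combination_spanning:
  assumes "\<omega> \<in> carrier (forms_module z)"
  obtains a where "(\<lambda>P w. \<omega> P w - combination a P w) \<in> nabla_image z c"
proof -
  obtain n A0 B0 where "\<omega> = rform z n A0 B0" using assms by (auto simp: carrier_forms_module)
  \<comment> \<open>The exponent is made a successor because \<open>nabla\<close> takes exponent
    \<open>n\<close> to \<open>Suc n\<close>.\<close>
  then obtain A B where \<omega>: "\<omega> = rform z (Suc n) A B"
    using rform_raise[of z n A0 B0 1] by auto
  obtain A' S where A: "A = twisted_num (\<lambda>j. 2 * c j) z {..4} n A' + S * root_poly z {3} * quintic z ^ n"
      and S: "degree S \<le> 3"
    using even.remainder_exists[of A n] by (auto simp: quintic_root_poly)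
  obtain B' S' where B: "B = twisted_num (\<lambda>j. 2 * c j - 1 / 2) z {..4} n B' + S' * root_poly z {0, 3, 4} * quintic z ^ n"
      and S': "degree S' \<le> 3"
    using odd.remainder_exists[of B n] by (auto simp: quintic_root_poly)
  obtain k where k: "S = (\<Sum>i<4. Polynomial.smult (k i) (cubic (z 1) (z 2) i))"
    using cubic_spanning[OF z12 S] by blast
  obtain k' where k': "S' = (\<Sum>i<4. Polynomial.smult (k' i) (cubic (z 1) (z 2) i))"
    using cubic_spanning[OF z12 S'] by blast
  define a where "a = (\<lambda>i. if i \<le> 4 then k (i - 1) else k' (i - 5))"
  have "combination a = rform z 1 (S * root_poly z {3}) (S' * root_poly z {0, 3, 4})"
    unfolding combination_eq k k' by (simp add: a_def)
  also have "\<dots> = rform z (Suc n) (S * root_poly z {3} * quintic z ^ n) (S' * root_poly z {0, 3, 4} * quintic z ^ n)"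
    by (subst rform_raise[of _ _ _ _ n]) simp
  finally have comb: "combination a = \<dots>" .
  have sum: "(\<lambda>P w. combination a P w + nabla z c (ratfun z n A' B') P w) = \<omega>"
    unfolding comb nabla_ratfun rform_add \<omega> A B by (simp add: add.commute)
  have "(\<lambda>P w. \<omega> P w - combination a P w) = nabla z c (ratfun z n A' B')"
    by (simp flip: sum)
  then show thesis using that[of a] nabla_ratfun_mem[of z c n A' B'] by simp
qed

section \<open>Passage to cohomology classes\<close>

interpretation Q: quotient_module "ring_of_type_algebra :: complex ring" "forms_module z" "nabla_image z c"
  by (rule quotient_module_forms)

lemma phi_mem_carrier: "i \<in> {1..8} \<Longrightarrow> \<phi> i \<in> carrier (forms_module z)"
  by (simp add: phi)

text \<open>Extending coefficients by zero reduces sums over a subset to combinations of all eight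
  forms, so one independence and one spanning lemma serve all three bases.\<close>

lemma finsum_phi:
  assumes "I \<subseteq> {1..8}"
  shows "(\<Oplus>\<^bsub>forms_module z\<^esub>i\<in>I. a i \<odot>\<^bsub>forms_module z\<^esub> \<phi> i) \<in> carrier (forms_module z)"
    and "(\<Oplus>\<^bsub>forms_module z\<^esub>i\<in>I. a i \<odot>\<^bsub>forms_module z\<^esub> \<phi> i)
      = combination (\<lambda>i. if i \<in> I then a i else 0)"
proof -
  have fin: "finite I" using assms by (rule finite_subset) simp
  have "a i \<odot>\<^bsub>forms_module z\<^esub> \<phi> i \<in> carrier (forms_module z)" if "i \<in> I" for i
    using phi_mem_carrier[of i] that assms by (intro Q.smult_closed) (auto simp: ring_of_type_algebra_def)
  then have v: "(\<lambda>i. a i \<odot>\<^bsub>forms_module z\<^esub> \<phi> i) \<in> I \<rightarrow> carrier (forms_module z)" by blast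
  then show "(\<Oplus>\<^bsub>forms_module z\<^esub>i\<in>I. a i \<odot>\<^bsub>forms_module z\<^esub> \<phi> i) \<in> carrier (forms_module z)"
    by (rule Q.M.finsum_closed)
  have "(\<Sum>i\<in>I. a i * \<phi> i P w) = (\<Sum>i\<in>{1..8}. (if i \<in> I then a i else 0) * \<phi> i P w)" for P w
    using assms by (intro sum.mono_neutral_cong_left) auto
  then show "(\<Oplus>\<^bsub>forms_module z\<^esub>i\<in>I. a i \<odot>\<^bsub>forms_module z\<^esub> \<phi> i)
      = combination (\<lambda>i. if i \<in> I then a i else 0)"
    unfolding forms_module_finsum[OF fin v] by (simp add: combination_def)
qed

lemma phi_independent:
  assumes "I \<subseteq> {1..8}"
    and "(\<Oplus>\<^bsub>forms_module z\<^esub>i\<in>I. a i \<odot>\<^bsub>forms_module z\<^esub> \<phi> i) \<in> nabla_image z c" "i \<in> I"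
  shows "a i = 0"
proof -
  have "i \<in> {1..8}" using assms by blast
  then show ?thesis
    using combination_independent[of "\<lambda>i. if i \<in> I then a i else 0" i] assms(2,3)
    unfolding finsum_phi(2)[OF assms(1)] by simp
qed

lemma phi_basis: "module_basis (ring_of_type_algebra :: complex ring) (H1 z c) {1..8} (\<lambda>i. H1_class z c (\<phi> i))"
  unfolding H1_def H1_class_def nabla_image_def[symmetric]
proof (rule Q.module_basis_quotI)
  fix a :: "nat \<Rightarrow> complex"
  assume "(\<Oplus>\<^bsub>forms_module z\<^esub>i\<in>{1..8}. a i \<odot>\<^bsub>forms_module z\<^esub> \<phi> i) \<in> nabla_image z c"
  then show "\<forall>i\<in>{1..8}. a i = \<zero>\<^bsub>ring_of_type_algebra :: complex ring\<^esub>"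
    using phi_independent[OF order.refl] by (simp add: ring_of_type_algebra_def)
next
  fix \<omega> assume "\<omega> \<in> carrier (forms_module z)"
  then obtain a where a: "(\<lambda>P w. \<omega> P w - combination a P w) \<in> nabla_image z c"
    by (rule combination_spanning)
  have "combination (\<lambda>i. if i \<in> {1..8} then a i else 0) = combination a"
    by (simp add: combination_def)
  then have "\<omega> \<ominus>\<^bsub>forms_module z\<^esub> (\<Oplus>\<^bsub>forms_module z\<^esub>i\<in>{1..8}. a i \<odot>\<^bsub>forms_module z\<^esub> \<phi> i) \<in> nabla_image z c"
    unfolding forms_module_minus[OF finsum_phi(1)[OF order.refl]] unfolding finsum_phi(2)[OF order.refl]
    using a by (simp only:)
  moreover have "a \<in> {1..8} \<rightarrow> carrier (ring_of_type_algebra :: complex ring)"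
    by (simp add: ring_of_type_algebra_def)
  ultimately show "\<exists>a\<in>{1..8} \<rightarrow> carrier (ring_of_type_algebra :: complex ring).
      \<omega> \<ominus>\<^bsub>forms_module z\<^esub> (\<Oplus>\<^bsub>forms_module z\<^esub>i\<in>{1..8}. a i \<odot>\<^bsub>forms_module z\<^esub> \<phi> i) \<in> nabla_image z c"
    by blast
qed (use phi_mem_carrier in auto)

definition sign :: "nat \<Rightarrow> complex" where
  "sign i = (if i \<le> 4 then 1 else - 1)"

lemma iota_pullback_phi:
  assumes "i \<in> {1..8}"
  shows "iota_pullback (\<phi> i) P w = sign i * \<phi> i P w"
proof -
  have "iota_pullback (\<phi> i) = (\<lambda>P w. sign i * \<phi> i P w)"
    unfolding phi[OF assms] iota_pullback_rform rform_smult by (simp add: sign_def even_num_def odd_num_def)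
  then show ?thesis by simp
qed

lemma nabla_image_diff:
  "\<omega> \<in> nabla_image z c \<Longrightarrow> \<eta> \<in> nabla_image z c \<Longrightarrow> (\<lambda>P w. \<omega> P w - \<eta> P w) \<in> nabla_image z c"
  using nabla_image_add[OF _ nabla_image_uminus, of \<omega> z c \<eta>] by simp

text \<open>Spanning is deduced from the eight forms: if a combination represents an eigenclass for
  \<open>s\<close>, then applying \<open>iota_pullback\<close> minus \<open>s\<close> and using
  independence removes every form of the other sign.\<close>

lemma phi_basis_eigen:
  "module_basis (ring_of_type_algebra :: complex ring) (H1_eigen z c s) {i \<in> {1..8}. sign i = s}
     (\<lambda>i. H1_class z c (\<phi> i))"
  unfolding H1_eigen_def H1_def H1_class_def nabla_image_def[symmetric]
proof (rule Q.module_basis_eigenspaceI)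
  let ?I = "{i \<in> {1..8}. sign i = s}" and ?M = "forms_module z"
  have I: "?I \<subseteq> {1..8}" by blast
  have smult: "(\<lambda>P w. s * \<omega> P w) \<in> carrier ?M" if "\<omega> \<in> carrier ?M" for \<omega>
    using Q.smult_closed[of s \<omega>] that by (simp add: ring_of_type_algebra_def)
  show "s \<in> carrier (ring_of_type_algebra :: complex ring)" by (simp add: ring_of_type_algebra_def)
  show "finite ?I" by simp
  show "\<phi> \<in> ?I \<rightarrow> carrier ?M" using phi_mem_carrier by simp
  show "iota_pullback \<omega> \<in> carrier ?M" if "\<omega> \<in> carrier ?M" for \<omega>
    using that by (rule common_denominator[OF _ that]) (simp add: iota_pullback_rform)
  show "iota_pullback (\<omega> \<oplus>\<^bsub>?M\<^esub> \<eta>) = iota_pullback \<omega> \<oplus>\<^bsub>?M\<^esub> iota_pullback \<eta>" for \<omega> \<eta>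
    by (simp add: iota_pullback_def)
  show "iota_pullback (a \<odot>\<^bsub>?M\<^esub> \<omega>) = a \<odot>\<^bsub>?M\<^esub> iota_pullback \<omega>" for a \<omega>
    by (simp add: iota_pullback_def)
  show "iota_pullback ` nabla_image z c = nabla_image z c" by (rule iota_pullback_nabla_image)
  show "iota_pullback (\<phi> i) \<ominus>\<^bsub>?M\<^esub> s \<odot>\<^bsub>?M\<^esub> \<phi> i \<in> nabla_image z c" if "i \<in> ?I" for i
  proof -
    have "iota_pullback (\<phi> i) \<ominus>\<^bsub>?M\<^esub> s \<odot>\<^bsub>?M\<^esub> \<phi> i = (\<lambda>P w. 0)"
      using that smult[OF phi_mem_carrier] by (simp add: forms_module_minus iota_pullback_phi)
    then show ?thesis
      using Q.additive_subgroup_axioms additive_subgroup.zero_closed by fastforce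
  qed
  show "\<forall>i\<in>?I. a i = \<zero>\<^bsub>ring_of_type_algebra :: complex ring\<^esub>"
    if "(\<Oplus>\<^bsub>?M\<^esub>i\<in>?I. a i \<odot>\<^bsub>?M\<^esub> \<phi> i) \<in> nabla_image z c" for a
    using phi_independent[OF I that] by (simp add: ring_of_type_algebra_def)
  show "\<exists>a\<in>?I \<rightarrow> carrier (ring_of_type_algebra :: complex ring).
      \<omega> \<ominus>\<^bsub>?M\<^esub> (\<Oplus>\<^bsub>?M\<^esub>i\<in>?I. a i \<odot>\<^bsub>?M\<^esub> \<phi> i) \<in> nabla_image z c"
    if \<omega>: "\<omega> \<in> carrier ?M" and "iota_pullback \<omega> \<ominus>\<^bsub>?M\<^esub> s \<odot>\<^bsub>?M\<^esub> \<omega> \<in> nabla_image z c" for \<omega>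
  proof -
    have eigen: "(\<lambda>P w. iota_pullback \<omega> P w - s * \<omega> P w) \<in> nabla_image z c"
      using that smult[of \<omega>] by (simp add: forms_module_minus)
    obtain a where a: "(\<lambda>P w. \<omega> P w - combination a P w) \<in> nabla_image z c" (is "?\<eta> \<in> _")
      using \<omega> by (rule combination_spanning)
    then have "iota_pullback ?\<eta> \<in> nabla_image z c"
      using iota_pullback_nabla_image by blast
    \<comment> \<open>The operator \<open>iota_pullback - s\<close> sends both
      \<open>\<omega>\<close> and the error \<open>?\<eta>\<close> into the image, hence also their
      difference, the combination with coefficients \<open>a\<close>.\<close>
    then have "(\<lambda>P w. (iota_pullback \<omega> P w - s * \<omega> P w) - (iota_pullback ?\<eta> P w - s * ?\<eta> P w)) \<in> nabla_image z c"
      by (rule nabla_image_diff[OF eigen nabla_image_diff[OF _ nabla_image_smult[OF a]]])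
    also have "(\<lambda>P w. (iota_pullback \<omega> P w - s * \<omega> P w) - (iota_pullback ?\<eta> P w - s * ?\<eta> P w))
        = combination (\<lambda>i. (sign i - s) * a i)"
    proof -
      have iota_\<eta>: "iota_pullback ?\<eta> P w = iota_pullback \<omega> P w - combination (\<lambda>i. sign i * a i) P w" for P w
      proof -
        have "(\<Sum>i\<in>{1..8}. a i * iota_pullback (\<phi> i) P w) = (\<Sum>i\<in>{1..8}. sign i * a i * \<phi> i P w)"
          by (intro sum.cong refl) (simp add: iota_pullback_phi)
        then show ?thesis by (simp add: iota_pullback_def combination_def)
      qed
      show ?thesis unfolding iota_\<eta>
        by (simp add: combination_def algebra_simps sum_subtractf sum_distrib_left)
    qed
    finally have "(sign i - s) * a i = 0" if "i \<in> {1..8}" for i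
      using combination_independent that by blast
    then have "combination (\<lambda>i. if i \<in> ?I then a i else 0) = combination a"
      unfolding combination_def by (intro ext sum.cong) auto
    then have "\<omega> \<ominus>\<^bsub>?M\<^esub> (\<Oplus>\<^bsub>?M\<^esub>i\<in>?I. a i \<odot>\<^bsub>?M\<^esub> \<phi> i) \<in> nabla_image z c"
      unfolding forms_module_minus[OF finsum_phi(1)[OF I]] unfolding finsum_phi(2)[OF I]
      using a by (simp only:)
    then show ?thesis by (intro bexI[of _ a]) (auto simp: ring_of_type_algebra_def)
  qed
qed

end

theorem corollary4p2:
  fixes z c :: "nat \<Rightarrow> complex" and \<phi> :: "nat \<Rightarrow> form"
  assumes z0: "z 0 = 0" and z4: "z 4 = 1"
    and z_mem: "\<And>j. j \<in> {1, 2, 3} \<Longrightarrow> z j \<in> UNIV - {0, 1}"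
    and z_distinct: "z 1 \<noteq> z 2" "z 1 \<noteq> z 3" "z 2 \<noteq> z 3"
    and c_sum: "(\<Sum>j\<le>5. c j) = 0"
    and c_generic: "\<And>j. j \<le> 5 \<Longrightarrow> 4 * c j \<notin> \<int>"
    and phi1: "\<phi> 1 = dx_form z (\<lambda>(x, y). 1 / (x - 1))"
    and phi2: "\<phi> 2 = dx_form z (\<lambda>(x, y). 1 / (x * (x - 1)))"
    and phi3: "\<phi> 3 = dx_form z (\<lambda>(x, y). (1 - z 1) / ((x - 1) * (x - z 1)))"
    and phi4: "\<phi> 4 = dx_form z (\<lambda>(x, y). (1 - z 2) / ((x - 1) * (x - z 2)))"
    and phi5: "\<phi> 5 = dx_form z (\<lambda>(x, y). x / y)"
    and phi6: "\<phi> 6 = dx_form z (\<lambda>(x, y). 1 / y)"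
    and phi7: "\<phi> 7 = dx_form z (\<lambda>(x, y). (1 - z 1) * (x / ((x - z 1) * y)))"
    and phi8: "\<phi> 8 = dx_form z (\<lambda>(x, y). (1 - z 2) * (x / ((x - z 2) * y)))"
  shows "module_basis (ring_of_type_algebra :: complex ring) (H1_eigen z c 1)
           {1..4} (\<lambda>i. H1_class z c (\<phi> i))
       \<and> module_basis (ring_of_type_algebra :: complex ring) (H1_eigen z c (- 1))
           {5..8} (\<lambda>i. H1_class z c (\<phi> i))
       \<and> module_basis (ring_of_type_algebra :: complex ring) (H1 z c)
           {1..8} (\<lambda>i. H1_class z c (\<phi> i))"
proof -
  have atMost4: "{..4::nat} = {0, 1, 2, 3, 4}" by auto
  have q: "poly (quintic z) x = x * (x - z 1) * (x - z 2) * (x - z 3) * (x - 1)" for x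
    by (simp add: quintic_root_poly poly_root_poly atMost4 z0 z4 mult.assoc)
  have p: "poly (root_poly z {3}) x = x - z 3" "poly (root_poly z {0, 3, 4}) x = x * (x - z 3) * (x - 1)" for x
    by (simp_all add: poly_root_poly z0 z4 mult.assoc)
  have nz: "x \<noteq> 0 \<and> x - 1 \<noteq> 0 \<and> x - z 1 \<noteq> 0 \<and> x - z 2 \<noteq> 0 \<and> x - z 3 \<noteq> 0 \<and> y \<noteq> 0"
    if "(x, y) \<in> curve z" for x y
    using curve_quintic_nonzero[OF that] that by (auto simp: q mem_curve_iff)
  \<comment> \<open>Each given form is matched with its numerators after multiplication by the
    quintic in factored form.\<close>
  have rform: "dx_form z (\<lambda>(x, y). h x y) = rform z 1 (even_num z i) (odd_num z i)"
    if "\<And>x y. (x, y) \<in> curve z \<Longrightarrow> h x y * (x * (x - z 1) * (x - z 2) * (x - z 3) * (x - 1))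
      = poly (even_num z i) x + poly (odd_num z i) x / y" for h i
  proof (rule dx_form_eq_rform)
    fix x y assume xy: "(x, y) \<in> curve z"
    show "(case (x, y) of (x, y) \<Rightarrow> h x y)
        = (poly (even_num z i) x + poly (odd_num z i) x / y) / poly (quintic z) x ^ 1"
      using that[OF xy] nz[OF xy] by (simp add: q flip: that[OF xy])
  qed
  note num_defs = even_num_def odd_num_def cubic_def p
  have rforms:
    "\<phi> 1 = rform z 1 (even_num z 1) (odd_num z 1)" "\<phi> 2 = rform z 1 (even_num z 2) (odd_num z 2)"
    "\<phi> 3 = rform z 1 (even_num z 3) (odd_num z 3)" "\<phi> 4 = rform z 1 (even_num z 4) (odd_num z 4)"
    "\<phi> 5 = rform z 1 (even_num z 5) (odd_num z 5)" "\<phi> 6 = rform z 1 (even_num z 6) (odd_num z 6)"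
    "\<phi> 7 = rform z 1 (even_num z 7) (odd_num z 7)" "\<phi> 8 = rform z 1 (even_num z 8) (odd_num z 8)"
    unfolding phi1 phi2 phi3 phi4 phi5 phi6 phi7 phi8
    by (rule rform, drule nz, simp add: num_defs mult_ac del: mult_pCons_left mult_pCons_right)+
  interpret basis_forms z c \<phi>
  proof
    show "inj_on z {..4}"
      using z_mem[of 1] z_mem[of 2] z_mem[of 3] z_distinct by (auto simp: inj_on_def atMost4 z0 z4)
    show "\<phi> i = rform z 1 (even_num z i) (odd_num z i)" if "i \<in> {1..8}" for i
    proof -
      have "i \<in> {1, 2, 3, 4, 5, 6, 7, 8}" using that by auto
      then show ?thesis using rforms by auto
    qed
  qed (use z0 z4 c_sum c_generic in auto)
  have "{i \<in> {1..8}. sign i = 1} = {1..4}" "{i \<in> {1..8}. sign i = - 1} = {5..8}"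
    by (auto simp: sign_def split: if_splits)
  then show ?thesis using phi_basis phi_basis_eigen[of 1] phi_basis_eigen[of "- 1"] by simp
qed

end
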